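(* Let $\varphi$ and $\psi$ be Young functions with $\varphi(1)=\psi(1)=1$ such that for some real $R>1$ and some integer $n_0\geq 1$ $$\frac{\varphi(R^k)}{\varphi(R^{k+1})}\leq \frac{\varphi(R^{k-1})}{\varphi(R^{k})}\quad\text{for all integers } k\geq 1,\qquad\text{and}\qquad \sum_{k=0}^{\infty}\frac{\varphi(R^k)}{\psi(R^{k+n_0})}<\infty .$$ Then there is a constant $0<K<\infty$ depending only on $(\varphi,\psi)$ such that for every compact metric space $(T,d)$ and every Borel probability measure $m$ on $T$ the following hold. (i) There is a Borel probability measure $\nu$ on $T\times T$ such that for every continuous $f:T\to\mathbb{R}$, with $f^d(u,v)=\frac{|f(u)-f(v)|}{d(u,v)}$ and $\psi_+(x)=\max(\psi(x)-1,0)$, one has $|f(s)-f(t)|\leq K|f^d|^{\nu}_{\psi_+}\tau_{m,\varphi}(s,t)$ for all $s,t\in T$, and, if $\psi\in\nabla'$, also $\sup_{s,t\in T}\psi_+\big(\frac{|f(s)-f(t)|}{Kr\tau_{m,\varphi}(s,t)}\big)\leq\int_{T\times T}\psi_+(f^d(u,v))\,\nu(du,dv)$, where $r>1$ is such that $\psi(x)\psi(y)\leq\psi(rxy)$ for all $x,y\geq 1$. (ii) For each separable stochastic process $X(t)$, $t\in T$, satisfying $\sup_{s,t\in T}\mathbf{E}\,\psi\big(\frac{|X(s)-X(t)|}{d(s,t)}\big)\leq 1$, there holds $$\mathbf{E}\sup_{s,t\in T}\frac{|X(s)-X(t)|}{2K\tau_{m,\varphi}(s,t)}\leq 1,$$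 and if $\psi\in\nabla'$ then also $$\mathbf{E}\sup_{s,t\in T}\psi\Big(\frac{|X(s)-X(t)|}{2K\tau_{m,\varphi}(s,t)}\Big)\leq 1 .$$
   Context: A (finite) Young function is an increasing (non-decreasing) convex function $\varphi:[0,\infty)\to[0,\infty)$ with $\varphi(0)=0$ and $\lim_{x\to\infty}\varphi(x)=\infty$. If $\varphi(1)=1$, then for $y\geq 1$, $\varphi^{-1}(y)$ is the unique $x$ with $\varphi(x)=y$, and $\varphi^{-1}(\infty)=\infty$. $\nabla'$ is the set of finite Young functions $\psi$ for which there are $c\geq 0$, $r>1$ with $\psi(x)\psi(y)\leq\psi(rxy)$ for all $x,y\geq c$. (If this holds for some $c>0$, it holds for every $c'>0$ with an appropriate $r'$.) For a Borel probability measure $\mu$ on a space $X$ and a measurable $h$, $|h|^{\mu}_{\psi_+}:=\inf\{a>0:\int_X\psi_+(|h|/a)\,d\mu\leq 1\}$ (with $\inf\emptyset=\infty$). For a compact metric space $(T,d)$ and a Borel probability measure $m$ on $T$, $B(x,\varepsilon)=\{y\in T:d(x,y)\leq\varepsilon\}$ and the minorizing metric is $$\tau_{m,\varphi}(s,t):=\max\Big\{\int_0^{d(s,t)}\varphi^{-1}\Big(\frac{1}{m(B(s,\varepsilon))}\Big)d\varepsilon,\ \int_0^{d(s,t)}\varphi^{-1}\Big(\frac{1}{m(B(t,\varepsilon))}\Big)d\varepsilon\Big\}\in[0,\infty].$$ Conventions: $0/0=0$, $1/0=\infty$, and $x/\infty=0$ for finite $x$; the first inequality in (i) is regarded as trivially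 true when $\tau_{m,\varphi}(s,t)=\infty$. Processes are real-valued, and "separable" is meant in the usual (Doob) sense.
   Formalization: In (ii), E sup is the essential supremum (over countable subsets of T); the pointwise sup is bounded only if X is also separable for d's topology refined by τ-balls, as it fails for some Doob separable X. K is stated per carrier type of T and Ω; continuum-size types give one K. *)

theory Defs
  imports "HOL-Analysis.Analysis" "HOL-Probability.Probability"
begin

(* Functions on [0,\<infinity>) are represented by functions real => real of which only the
   restriction to {0..} is ever used. *)

definition young_function :: "(real \<Rightarrow> real) \<Rightarrow> bool" where
  "young_function \<phi> \<longleftrightarrow>
     mono_on {0..} \<phi> \<and> convex_on {0..} \<phi> \<and> \<phi> 0 = 0 \<and> filterlim \<phi> at_top at_top"

definition nabla_prime :: "(real \<Rightarrow> real) set" where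
  "nabla_prime = {\<psi>. young_function \<psi> \<and>
     (\<exists>c\<ge>0. \<exists>r>1. \<forall>x\<ge>c. \<forall>y\<ge>c. \<psi> x * \<psi> y \<le> \<psi> (r * x * y))}"

(* Only used at arguments y \<ge> 1, for \<phi> with \<phi> 1 = 1; then the preimage is unique. *)
definition young_inv :: "(real \<Rightarrow> real) \<Rightarrow> ennreal \<Rightarrow> ennreal" where
  "young_inv \<phi> y = (if y = \<infinity> then \<infinity> else ennreal (THE x. 0 \<le> x \<and> \<phi> x = enn2real y))"

definition plus_part :: "(real \<Rightarrow> real) \<Rightarrow> real \<Rightarrow> real" where
  "plus_part \<psi> x = max (\<psi> x - 1) 0"

(* Extension of a function on [0,\<infinity>) that tends to infinity to [0,\<infinity>]. *)
definition ext_top :: "(real \<Rightarrow> real) \<Rightarrow> ennreal \<Rightarrow> ennreal" where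
  "ext_top \<psi> y = (if y = \<infinity> then \<infinity> else ennreal (\<psi> (enn2real y)))"

definition luxemburg :: "(real \<Rightarrow> real) \<Rightarrow> 'x measure \<Rightarrow> ('x \<Rightarrow> real) \<Rightarrow> ennreal" where
  "luxemburg \<Psi> \<mu> h =
     Inf {ennreal a | a. a > 0 \<and> (\<integral>\<^sup>+ x. ennreal (\<Psi> (\<bar>h x\<bar> / a)) \<partial>\<mu>) \<le> 1}"

definition borel_probability :: "'x topology \<Rightarrow> 'x measure \<Rightarrow> bool" where
  "borel_probability A \<mu> \<longleftrightarrow>
     prob_space \<mu> \<and> space \<mu> = topspace A \<and> sets \<mu> = sigma_sets (topspace A) {U. openin A U}"

definition minorizing_integral ::
  "'a set \<Rightarrow> ('a \<Rightarrow> 'a \<Rightarrow> real) \<Rightarrow> 'a measure \<Rightarrow> (real \<Rightarrow> real) \<Rightarrow> 'a \<Rightarrow> real \<Rightarrow> ennreal" where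
  "minorizing_integral T d m \<phi> s \<delta> =
     (\<integral>\<^sup>+ \<epsilon>\<in>{0..\<delta>}. young_inv \<phi> (1 / emeasure m (Metric_space.mcball T d s \<epsilon>)) \<partial>lborel)"

definition minorizing_metric ::
  "'a set \<Rightarrow> ('a \<Rightarrow> 'a \<Rightarrow> real) \<Rightarrow> 'a measure \<Rightarrow> (real \<Rightarrow> real) \<Rightarrow> 'a \<Rightarrow> 'a \<Rightarrow> ennreal" where
  "minorizing_metric T d m \<phi> s t =
     max (minorizing_integral T d m \<phi> s (d s t)) (minorizing_integral T d m \<phi> t (d s t))"

(* Division in real gives the convention 0/0 = 0 on the diagonal. *)
definition diff_quotient :: "('a \<Rightarrow> 'a \<Rightarrow> real) \<Rightarrow> ('a \<Rightarrow> real) \<Rightarrow> 'a \<times> 'a \<Rightarrow> real" where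
  "diff_quotient d f = (\<lambda>(u, v). \<bar>f u - f v\<bar> / d u v)"

(* |f(s)-f(t)| / (c \<tau>(s,t)) in [0,\<infinity>]; in ennreal 0/0 = 0, x/0 = \<infinity> for x > 0, and x/\<infinity> = 0. *)
definition scaled_increment ::
  "real \<Rightarrow> ('a \<Rightarrow> 'a \<Rightarrow> ennreal) \<Rightarrow> ('a \<Rightarrow> real) \<Rightarrow> 'a \<Rightarrow> 'a \<Rightarrow> ennreal" where
  "scaled_increment c \<tau> f s t = ennreal \<bar>f s - f t\<bar> / (ennreal c * \<tau> s t)"

(* Separability in the sense of Doob of a process indexed by topspace A, relative to closed sets. *)
definition doob_separable :: "'b measure \<Rightarrow> 'a topology \<Rightarrow> ('a \<Rightarrow> 'b \<Rightarrow> real) \<Rightarrow> bool" where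
  "doob_separable M A X \<longleftrightarrow>
     (\<exists>S N. countable S \<and> S \<subseteq> topspace A \<and> N \<in> null_sets M \<and>
        (\<forall>G F. openin A G \<longrightarrow> closed F \<longrightarrow>
           {\<omega> \<in> space M. \<forall>t\<in>G \<inter> S. X t \<omega> \<in> F} - {\<omega> \<in> space M. \<forall>t\<in>G. X t \<omega> \<in> F} \<subseteq> N))"

(* Expectation of the lattice (essential) supremum of the random variables
   \<omega> \<mapsto> F (\<lambda>t. X t \<omega>) s t, s, t \<in> T: the essential supremum of a family of
   measurable functions is attained by the pointwise supremum over some countable subfamily. *)
definition expectation_sup ::
  "'b measure \<Rightarrow> 'a set \<Rightarrow> ('a \<Rightarrow> 'b \<Rightarrow> real) \<Rightarrow> (('a \<Rightarrow> real) \<Rightarrow> 'a \<Rightarrow> 'a \<Rightarrow> ennreal) \<Rightarrow> ennreal" where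
  "expectation_sup M T X F =
     (SUP S\<in>{S. countable S \<and> S \<subseteq> T}. \<integral>\<^sup>+ \<omega>. (SUP s\<in>S. SUP t\<in>S. F (\<lambda>u. X u \<omega>) s t) \<partial>M)"

definition expectation_pointwise_sup ::
  "'b measure \<Rightarrow> 'a set \<Rightarrow> ('a \<Rightarrow> 'b \<Rightarrow> real) \<Rightarrow> (('a \<Rightarrow> real) \<Rightarrow> 'a \<Rightarrow> 'a \<Rightarrow> ennreal) \<Rightarrow> ennreal" where
  "expectation_pointwise_sup M T X F =
     (\<integral>\<^sup>+ \<omega>. (SUP s\<in>T. SUP t\<in>T. F (\<lambda>u. X u \<omega>) s t) \<partial>M)"

(* The topology of d, refined by the balls of the minorizing metric around those points that are
   at finite minorizing distance from nearby points. It is the topology of d itself when the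
   minorizing metric is continuous.

   For a process that is Doob separable only for the topology of d, the pointwise supremum of
   |X(s)-X(t)| / \<tau>(s,t) can strictly exceed the essential one, as \<tau>(s,t) may be finite although
   \<tau>(s',t) is infinite at the points s' of a separating set approximating s. Take
   T = [0,1] x ({0} Un {y_n. n}) with y_n --> 0 isolated, and m the Lebesgue measure of [0,1] x {0}.
   Let X(u,y_n) = Y_n, with Y_n independent, in {0,L}, and equal to L infinitely often; let
   X(u,0) = 0 for u ~= U, and X(U,0) = L, with U uniform and independent of (Y_n). The process X is
   Doob separable, {Y_n = L} can be made rare enough for the increment condition to hold, \<tau> is
   bounded on [0,1] x {0}, and the pointwise supremum is at least of order L, L arbitrary. *)
definition minorizing_topology ::
  "'a set \<Rightarrow> ('a \<Rightarrow> 'a \<Rightarrow> real) \<Rightarrow> 'a measure \<Rightarrow> (real \<Rightarrow> real) \<Rightarrow> 'a topology" where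
  "minorizing_topology T d m \<phi> = topology_generated_by
     ({U. openin (Metric_space.mtopology T d) U} \<union>
      {{s \<in> T. minorizing_metric T d m \<phi> s t < ennreal e} | t e.
          t \<in> T \<and> e > 0 \<and> minorizing_integral T d m \<phi> t 1 < \<infinity>})"

end

theory Submission
  imports Defs
begin

text \<open>
  Put \<open>a\<^sub>k = \<phi>(R\<^sup>k)\<close> and let \<open>r\<^sub>k(x)\<close> be the smallest radius of a ball around \<open>x\<close> of mass at
  least \<open>1 / a\<^sub>k\<close>. Greedy packing by such balls, the smallest ones first, gives a net \<open>T\<^sub>k\<close> of at most
  \<open>a\<^sub>k\<close> points that contains a point within \<open>3 r\<^sub>k(x)\<close> of every \<open>x\<close>. Chain from \<open>s\<close> and from \<open>t\<close> through
  \<open>T\<^sub>n, T\<^sub>n\<^sub>-\<^sub>1, \<dots>\<close>, each point being projected to the next coarser net, and jump from one chain to the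
  other at the first level where \<open>r\<^sub>k\<^sub>-\<^sub>1\<close> exceeds the distance of the chains. Such a jump joins points
  of \<open>T\<^sub>k\<close> whose balls are packed into a ball of mass at most \<open>1 / a\<^sub>k\<^sub>-\<^sub>1\<close>, so that there are at most
  \<open>a\<^sub>k\<^sup>2 / a\<^sub>k\<^sub>-\<^sub>1 \<le> a\<^sub>k\<^sub>+\<^sub>1\<close> of them by the ratio condition on \<open>\<phi>\<close>. Since \<open>\<Sum>\<^sub>k R\<^sup>k r\<^sub>k(x)\<close>, truncated at
  \<open>d(s,t)\<close>, is at most twice the minorizing integral, a function whose difference quotient is at
  most \<open>\<Lambda> R\<^sup>k\<close> on the links of level \<open>k\<close> satisfies \<open>|f(s) - f(t)| \<le> 2 R \<Lambda> \<tau>(s,t)\<close>. The measure \<open>\<nu>\<close> puts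
  mass \<open>1 / \<psi>(R\<^sup>k\<^sup>+\<^sup>N)\<close> on every link of level \<open>k\<close>, and for both the continuous functions and the
  processes \<open>\<Lambda>\<close> is controlled by the \<open>\<psi>\<^sub>+\<close>-integral of the difference quotient.
\<close>

subsection \<open>Young functions\<close>

lemma young_mono: "young_function \<phi> \<Longrightarrow> 0 \<le> x \<Longrightarrow> x \<le> y \<Longrightarrow> \<phi> x \<le> \<phi> y"
  by (auto simp: young_function_def mono_on_def)

lemma young_nonneg: "young_function \<phi> \<Longrightarrow> 0 \<le> x \<Longrightarrow> 0 \<le> \<phi> x"
  using young_mono[of \<phi> 0 x] by (simp add: young_function_def)

lemma young_scale_le:
  assumes "young_function \<phi>" "0 \<le> c" "c \<le> 1" "0 \<le> x"
  shows "\<phi> (c * x) \<le> c * \<phi> x"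
proof -
  have "convex_on {0..} \<phi>" "\<phi> 0 = 0" using assms(1) by (auto simp: young_function_def)
  from convex_onD[OF this(1), of c 0 x] show ?thesis using assms \<open>\<phi> 0 = 0\<close> by simp
qed

lemma young_scale_ge:
  assumes "young_function \<phi>" "1 \<le> c" "0 \<le> x"
  shows "c * \<phi> x \<le> \<phi> (c * x)"
proof -
  have "\<phi> (1 / c * (c * x)) \<le> 1 / c * \<phi> (c * x)"
    using assms by (intro young_scale_le) auto
  then show ?thesis using assms by (simp add: field_simps)
qed

text \<open>\<phi> may vanish on an initial interval, so strictness is claimed only below a positive
  value; there convexity through the origin supplies the factor \<open>x / y < 1\<close>.\<close>

lemma young_strict:
  assumes "young_function \<phi>" "0 \<le> x" "x < y" "0 < \<phi> y"
  shows "\<phi> x < \<phi> y"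
proof -
  have "\<phi> (x / y * y) \<le> x / y * \<phi> y"
    using assms by (intro young_scale_le) auto
  also have "\<dots> < \<phi> y" using assms by (simp add: field_simps)
  finally show ?thesis using assms by simp
qed

lemma young_le_cancel:
  assumes "young_function \<phi>" "0 \<le> y" "\<phi> x \<le> \<phi> y" "0 < \<phi> x"
  shows "x \<le> y"
  using young_strict[of \<phi> y x] assms by (meson not_less order.strict_trans2 leD)

lemma young_ge_self:
  assumes "young_function \<phi>" "\<phi> 1 = 1" "1 \<le> x"
  shows "x \<le> \<phi> x"
  using young_scale_ge[of \<phi> x 1] assms by simp

lemma young_preimage:
  assumes \<phi>: "young_function \<phi>" "\<phi> 1 = 1" and y: "1 \<le> y"
  obtains x where "1 \<le> x" "\<phi> x = y"
proof -
  \<comment> \<open>Convexity yields continuity on open sets, so the origin is dropped; the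
    intermediate value theorem on \<open>{1..y}\<close> then uses
    \<open>y \<le> \<phi> y\<close>.\<close>
  have "convex_on {0<..} \<phi>"
    using \<phi> by (auto simp: young_function_def intro: convex_on_subset)
  then have "continuous_on {0<..} \<phi>" by (intro convex_on_continuous) auto
  then have "continuous_on {1..y} \<phi>" by (rule continuous_on_subset) auto
  then have "\<exists>x\<ge>1. x \<le> y \<and> \<phi> x = y"
    using young_ge_self[OF \<phi> y] \<phi> y by (intro IVT') auto
  then show ?thesis using that by blast
qed

lemma young_inv_eq:
  assumes \<phi>: "young_function \<phi>" "\<phi> 1 = 1" and x: "1 \<le> x"
  shows "young_inv \<phi> (ennreal (\<phi> x)) = ennreal x"
proof -
  have pos: "0 < \<phi> x" using young_ge_self[OF \<phi> x] x by linarith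
  have "(THE z. 0 \<le> z \<and> \<phi> z = \<phi> x) = x"
  proof (rule the_equality)
    fix z assume z: "0 \<le> z \<and> \<phi> z = \<phi> x"
    have "x \<le> z" by (rule young_le_cancel[OF \<phi>(1)]) (use z pos in simp_all)
    moreover have "z \<le> x" by (rule young_le_cancel[OF \<phi>(1)]) (use z pos x in simp_all)
    ultimately show "z = x" by simp
  qed (use x in auto)
  then show ?thesis using pos by (simp add: young_inv_def)
qed

lemma young_inv_cases:
  assumes \<phi>: "young_function \<phi>" "\<phi> 1 = 1" and y: "1 \<le> y" "y \<noteq> \<infinity>"
  obtains x where "1 \<le> x" "y = ennreal (\<phi> x)" "young_inv \<phi> y = ennreal x"
proof -
  obtain y' where y': "y = ennreal y'" "0 \<le> y'" using y by (cases y) auto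
  have "1 \<le> y'" using y y' by (simp flip: ennreal_1)
  then obtain x where "1 \<le> x" "\<phi> x = y'" using young_preimage[OF \<phi>] by metis
  then show ?thesis using that[of x] young_inv_eq[OF \<phi> \<open>1 \<le> x\<close>] y' by simp
qed

lemma young_inv_mono:
  assumes \<phi>: "young_function \<phi>" "\<phi> 1 = 1" and y: "1 \<le> y" "y \<le> y'"
  shows "young_inv \<phi> y \<le> young_inv \<phi> y'"
proof (cases "y' = \<infinity>")
  case True
  then show ?thesis by (simp add: young_inv_def)
next
  case False
  then obtain x where x: "1 \<le> x" "y = ennreal (\<phi> x)" "young_inv \<phi> y = ennreal x"
    using young_inv_cases[OF \<phi> y(1)] y by (metis infinity_ennreal_def neq_top_trans)
  obtain x' where x': "1 \<le> x'" "y' = ennreal (\<phi> x')" "young_inv \<phi> y' = ennreal x'"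
    using young_inv_cases[OF \<phi> order.trans[OF y] False] by blast
  have "0 < \<phi> x" using young_ge_self[OF \<phi> x(1)] x(1) by linarith
  moreover have "\<phi> x \<le> \<phi> x'"
    using y(2) young_nonneg[OF \<phi>(1), of x'] x'(1) unfolding x(2) x'(2) by simp
  ultimately have "x \<le> x'" using x'(1) by (auto intro!: young_le_cancel[OF \<phi>(1), of x' x])
  then show ?thesis using x x' by (simp add: ennreal_leI)
qed

lemma young_inv_ge:
  assumes \<phi>: "young_function \<phi>" "\<phi> 1 = 1" and x: "1 \<le> x" "ennreal (\<phi> x) \<le> y"
  shows "ennreal x \<le> young_inv \<phi> y"
proof -
  have "1 \<le> ennreal (\<phi> x)"
    using young_ge_self[OF \<phi> x(1)] x(1) by (simp flip: ennreal_1)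
  then show ?thesis using young_inv_mono[OF \<phi> _ x(2)] young_inv_eq[OF \<phi> x(1)] by simp
qed

text \<open>Multiplying both arguments by \<open>b = max c 1\<close> brings them above
  \<open>c\<close>; by monotonicity this only enlarges the left side, and \<open>r\<close> grows by
  the factor \<open>b\<^sup>2\<close>.\<close>

lemma nabla_prime_one:
  assumes "\<psi> \<in> nabla_prime"
  obtains r where "r > 1" "\<And>x y. 1 \<le> x \<Longrightarrow> 1 \<le> y \<Longrightarrow> \<psi> x * \<psi> y \<le> \<psi> (r * x * y)"
proof -
  obtain c r where \<psi>: "young_function \<psi>" and c: "0 \<le> c" "r > 1"
    and cr: "\<And>x y. c \<le> x \<Longrightarrow> c \<le> y \<Longrightarrow> \<psi> x * \<psi> y \<le> \<psi> (r * x * y)"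
    using assms by (auto simp: nabla_prime_def)
  define b where "b = max c 1"
  have b: "1 \<le> b" "c \<le> b" by (auto simp: b_def)
  show ?thesis
  proof
    show "r * b\<^sup>2 > 1" using c b by (simp add: less_1_mult' one_le_power)
  next
    fix x y :: real assume xy: "1 \<le> x" "1 \<le> y"
    have *: "c \<le> b * x" "c \<le> b * y" "x \<le> b * x" "y \<le> b * y"
      using b xy mult_left_mono[OF xy(1), of b] mult_left_mono[OF xy(2), of b]
        mult_right_mono[OF b(1), of x] mult_right_mono[OF b(1), of y] by linarith+
    have "\<psi> x * \<psi> y \<le> \<psi> (b * x) * \<psi> (b * y)"
      using * xy b by (intro mult_mono young_mono[OF \<psi>] young_nonneg[OF \<psi>]) auto
    also have "\<dots> \<le> \<psi> (r * (b * x) * (b * y))" using * by (intro cr)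
    also have "r * (b * x) * (b * y) = r * b\<^sup>2 * x * y" by (simp add: power2_eq_square)
    finally show "\<psi> x * \<psi> y \<le> \<psi> (r * b\<^sup>2 * x * y)" .
  qed
qed

text \<open>A \<open>p\<close>-step ratio is a product of \<open>p\<close> consecutive ratios, which
  log-convexity makes nondecreasing. This carries the ratio condition over to powers of the
  base.\<close>

lemma log_convex_ratio_mono:
  fixes b :: "nat \<Rightarrow> real"
  assumes pos: "\<And>k. 0 < b k" and lc: "\<And>k. (b (Suc k))\<^sup>2 \<le> b k * b (Suc (Suc k))" and "i \<le> j"
  shows "b (i + p) / b i \<le> b (j + p) / b j"
proof (induction p)
  case (Suc p)
  have "b (Suc k) / b k \<le> b (Suc (Suc k)) / b (Suc k)" for k
    using lc[of k] pos[of k] pos[of "Suc k"] by (simp add: field_simps power2_eq_square)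
  then have mono: "mono (\<lambda>k. b (Suc k) / b k)" by (simp add: mono_iff_le_Suc)
  have eq: "b (i + Suc p) / b i = (b (i + p) / b i) * (b (Suc (i + p)) / b (i + p))" for i
    using pos[of "i + p"] by simp
  show ?case unfolding eq
    using Suc monoD[OF mono, of "i + p" "j + p"] \<open>i \<le> j\<close> pos
    by (intro mult_mono) (auto intro: less_imp_le)
qed (use pos[of i] pos[of j] in simp)

text \<open>The given base is replaced by a power of itself that exceeds \<open>B\<close>, and the
  shift in the denominators is enlarged until the sum drops below one. The numerator
  \<open>2 * \<phi> (R ^ Suc (Suc k))\<close> is the later bound on the number of links of level
  \<open>k\<close>.\<close>

lemma chaining_parameters:
  assumes \<phi>: "young_function \<phi>" "\<phi> 1 = 1" and \<psi>: "young_function \<psi>" "\<psi> 1 = 1"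
    and ex: "\<exists>R::real. \<exists>n0::nat. R > 1 \<and> n0 \<ge> 1 \<and>
           (\<forall>k::nat. k \<ge> 1 \<longrightarrow> \<phi> (R ^ k) / \<phi> (R ^ (k + 1)) \<le> \<phi> (R ^ (k - 1)) / \<phi> (R ^ k)) \<and>
           summable (\<lambda>k::nat. \<phi> (R ^ k) / \<psi> (R ^ (k + n0)))"
    and "B \<ge> 0"
  obtains R :: real and N :: nat where "R \<ge> B" "R > 1"
    "\<And>k. (\<phi> (R ^ Suc k))\<^sup>2 \<le> \<phi> (R ^ k) * \<phi> (R ^ Suc (Suc k))"
    "summable (\<lambda>k. 2 * \<phi> (R ^ Suc (Suc k)) / \<psi> (R ^ (k + N)))"
    "(\<Sum>k. 2 * \<phi> (R ^ Suc (Suc k)) / \<psi> (R ^ (k + N))) \<le> 1"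
proof -
  obtain Q :: real and n0 :: nat where Q: "Q > 1"
    and rat: "\<And>k. k \<ge> 1 \<Longrightarrow> \<phi> (Q ^ k) / \<phi> (Q ^ (k + 1)) \<le> \<phi> (Q ^ (k - 1)) / \<phi> (Q ^ k)"
    and sm: "summable (\<lambda>k::nat. \<phi> (Q ^ k) / \<psi> (Q ^ (k + n0)))"
    using ex by blast
  have ge1: "1 \<le> x \<Longrightarrow> 1 \<le> \<phi> x" "1 \<le> x \<Longrightarrow> 1 \<le> \<psi> x" for x
    using young_ge_self[OF \<phi>, of x] young_ge_self[OF \<psi>, of x] by auto
  have posQ: "0 < \<phi> (Q ^ k)" "0 < \<psi> (Q ^ k)" for k
    using ge1[of "Q ^ k"] Q by (simp_all add: one_le_power)
  have lcQ: "(\<phi> (Q ^ Suc k))\<^sup>2 \<le> \<phi> (Q ^ k) * \<phi> (Q ^ Suc (Suc k))" for k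
    using rat[of "Suc k"] posQ(1)[of k] posQ(1)[of "Suc k"] posQ(1)[of "Suc (Suc k)"]
    by (simp add: field_simps power2_eq_square)
  \<comment> \<open>The 2 excludes \<open>p = 0\<close>.\<close>
  obtain p where p: "max B 2 < Q ^ p" using real_arch_pow[OF Q] by blast
  then have "p \<noteq> 0" by (intro notI) auto
  define R where "R = Q ^ p"
  have R: "R \<ge> B" "R \<ge> 2" using p by (auto simp: R_def)
  have Rk: "R ^ k = Q ^ (p * k)" for k by (simp add: R_def power_mult)
  have posR: "0 < \<phi> (R ^ k)" "0 < \<psi> (R ^ k)" for k by (simp_all add: Rk posQ)
  have lc: "(\<phi> (R ^ Suc k))\<^sup>2 \<le> \<phi> (R ^ k) * \<phi> (R ^ Suc (Suc k))" for k
  proof -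
    have "\<phi> (Q ^ (p * k + p)) / \<phi> (Q ^ (p * k))
        \<le> \<phi> (Q ^ (p * Suc k + p)) / \<phi> (Q ^ (p * Suc k))"
      using log_convex_ratio_mono[of "\<lambda>k. \<phi> (Q ^ k)" "p * k" "p * Suc k" p] posQ lcQ by simp
    then have "\<phi> (R ^ Suc k) / \<phi> (R ^ k) \<le> \<phi> (R ^ Suc (Suc k)) / \<phi> (R ^ Suc k)"
      by (simp only: Rk mult_Suc_right add.commute)
    then show ?thesis using posR[of k] posR[of "Suc k"]
      by (simp add: field_simps power2_eq_square del: power_Suc)
  qed
  have inj: "inj (\<lambda>k. p * k)" using \<open>p \<noteq> 0\<close> by (auto simp: inj_def)
  have smR: "summable (\<lambda>k. \<phi> (R ^ k) / \<psi> (R ^ (k + n0)))"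
  proof (rule summable_comparison_test')
    show "summable (\<lambda>k. \<phi> (Q ^ (p * k)) / \<psi> (Q ^ (p * k + n0)))"
      using summable_reindex[OF sm inj] posQ[THEN less_imp_le] by (simp add: o_def)
    fix k :: nat
    \<comment> \<open>The shift \<open>n0\<close> in powers of \<open>R\<close> is the larger shift
      \<open>p * n0\<close> in powers of \<open>Q\<close>.\<close>
    have "\<psi> (Q ^ (p * k + n0)) \<le> \<psi> (R ^ (k + n0))"
      unfolding Rk using Q \<open>p \<noteq> 0\<close>
      by (intro young_mono[OF \<psi>(1)] power_increasing) (auto simp: distrib_left)
    then show "norm (\<phi> (R ^ k) / \<psi> (R ^ (k + n0))) \<le> \<phi> (Q ^ (p * k)) / \<psi> (Q ^ (p * k + n0))"
      using posR posQ posQ[THEN less_imp_le] by (auto simp: Rk abs_of_pos intro!: divide_left_mono)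
  qed
  define S where "S = (\<Sum>k. \<phi> (R ^ Suc (Suc k)) / \<psi> (R ^ (Suc (Suc k) + n0)))"
  have smS: "summable (\<lambda>k. \<phi> (R ^ Suc (Suc k)) / \<psi> (R ^ (Suc (Suc k) + n0)))"
    using smR summable_Suc_iff[of "\<lambda>k. \<phi> (R ^ Suc k) / \<psi> (R ^ (Suc k + n0))"]
      summable_Suc_iff[of "\<lambda>k. \<phi> (R ^ k) / \<psi> (R ^ (k + n0))"] by blast
  \<comment> \<open>By convexity, \<open>n1\<close> further powers of \<open>R\<close> in the
    denominators divide the sum by at least \<open>R ^ n1\<close>, which absorbs
    \<open>2 * S\<close>.\<close>
  obtain n1 where n1: "2 * S < R ^ n1" using real_arch_pow[of R] R by force
  \<comment> \<open>The two successors match the index \<open>Suc (Suc k)\<close> of the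
    numerators.\<close>
  define N where "N = Suc (Suc n0) + n1"
  have bd: "2 * \<phi> (R ^ Suc (Suc k)) / \<psi> (R ^ (k + N))
      \<le> 2 / R ^ n1 * (\<phi> (R ^ Suc (Suc k)) / \<psi> (R ^ (Suc (Suc k) + n0)))" for k
  proof -
    have "R ^ n1 * \<psi> (R ^ (Suc (Suc k) + n0)) \<le> \<psi> (R ^ n1 * R ^ (Suc (Suc k) + n0))"
      using R by (intro young_scale_ge[OF \<psi>(1)]) (auto intro: one_le_power)
    also have "R ^ n1 * R ^ (Suc (Suc k) + n0) = R ^ (k + N)"
      by (simp add: N_def power_add)
    finally have "2 * \<phi> (R ^ Suc (Suc k)) / \<psi> (R ^ (k + N))
        \<le> 2 * \<phi> (R ^ Suc (Suc k)) / (R ^ n1 * \<psi> (R ^ (Suc (Suc k) + n0)))"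
      using posR(1)[of "Suc (Suc k)"] posR(2)[of "Suc (Suc k) + n0"] posR(2)[of "k + N"] R
      by (intro divide_left_mono mult_pos_pos) (auto simp del: power_Suc)
    then show ?thesis by simp
  qed
  have sm': "summable (\<lambda>k. 2 * \<phi> (R ^ Suc (Suc k)) / \<psi> (R ^ (k + N)))"
    by (rule summable_comparison_test'[OF summable_mult[OF smS, of "2 / R ^ n1"], of 0])
      (use bd posR in \<open>auto simp: abs_of_pos simp del: power_Suc\<close>)
  have "(\<Sum>k. 2 * \<phi> (R ^ Suc (Suc k)) / \<psi> (R ^ (k + N))) \<le> 2 / R ^ n1 * S"
    unfolding S_def using bd by (subst suminf_mult[OF smS, symmetric])
      (intro suminf_le sm' summable_mult smS)
  also have "\<dots> \<le> 1" using n1 R by (simp add: field_simps)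
  finally show ?thesis using that[OF R(1) _ lc sm'] R by simp
qed

lemma young_le_cancel_ge_1:
  assumes \<psi>: "young_function \<psi>" "\<psi> 1 = 1" and "1 \<le> y" "\<psi> x \<le> \<psi> y"
  shows "x \<le> y"
proof (rule ccontr)
  assume "\<not> x \<le> y"
  moreover have "1 \<le> \<psi> y" using young_ge_self[OF \<psi> \<open>1 \<le> y\<close>] \<open>1 \<le> y\<close> by linarith
  moreover have "\<psi> y \<le> \<psi> x" using calculation(1) \<open>1 \<le> y\<close> by (intro young_mono[OF \<psi>(1)]) auto
  ultimately show False using young_strict[OF \<psi>(1), of y x] assms by linarith
qed

lemma plus_part_nonneg [simp]: "0 \<le> plus_part \<psi> x"
  by (simp add: plus_part_def)

text \<open>The 1 subtracted in \<open>plus_part\<close> is absorbed by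
  \<open>\<psi> q \<ge> 1\<close>, so a weighted bound on one link becomes a bound relative to its
  scale \<open>q\<close>.\<close>

lemma plus_part_bound:
  assumes \<psi>: "young_function \<psi>" "\<psi> 1 = 1" and "0 \<le> w" "1 \<le> q"
    and "1 / \<psi> q * plus_part \<psi> z \<le> w"
  shows "\<psi> z \<le> (1 + w) * \<psi> q"
proof -
  have q: "1 \<le> \<psi> q" using young_ge_self[OF \<psi> \<open>1 \<le> q\<close>] \<open>1 \<le> q\<close> by linarith
  have "\<psi> z - 1 \<le> plus_part \<psi> z" by (simp add: plus_part_def)
  also have "\<dots> \<le> w * \<psi> q" using assms q by (simp add: field_simps)
  finally show ?thesis using q by (simp add: algebra_simps)
qed

text \<open>\<psi> is controlled only on the half-line. Composing it with \<open>max 0\<close> gives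
  a monotone, hence Borel, function that agrees with \<psi> at the values of
  \<open>g\<close>.\<close>

lemma young_measurable:
  assumes \<psi>: "young_function \<psi>" and [measurable]: "g \<in> borel_measurable M" and g: "\<And>x. 0 \<le> g x"
  shows "(\<lambda>x. \<psi> (g x)) \<in> borel_measurable M"
proof -
  have "mono (\<lambda>x. \<psi> (max 0 x))"
    by (intro monoI young_mono[OF \<psi>]) auto
  then have [measurable]: "(\<lambda>x. \<psi> (max 0 x)) \<in> borel_measurable borel"
    by (rule borel_measurable_mono)
  have "(\<lambda>x. \<psi> (max 0 (g x))) \<in> borel_measurable M" by measurable
  then show ?thesis using g by (simp add: max_def)
qed

text \<open>Reduces a bound in [0,\<infinity>] to a real inequality. If \<tau> is infinite the
  quotient is 0; if \<tau> is 0 the hypothesis forces the numerator to vanish, and 0/0 = 0.\<close>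

lemma scaled_increment_le:
  assumes c: "0 < c" and x: "0 \<le> x"
    and le: "\<And>b. \<tau> s t = ennreal b \<Longrightarrow> 0 \<le> b \<Longrightarrow> \<bar>f s - f t\<bar> \<le> c * x * b"
  shows "scaled_increment c \<tau> f s t \<le> ennreal x"
proof (cases "\<tau> s t")
  case (real b)
  then have le': "\<bar>f s - f t\<bar> \<le> c * x * b" using le by simp
  show ?thesis
  proof (cases "b = 0")
    case True
    then show ?thesis using le' by (simp add: scaled_increment_def)
  next
    case False
    then have "scaled_increment c \<tau> f s t = ennreal (\<bar>f s - f t\<bar> / (c * b))"
      using real c by (simp add: scaled_increment_def divide_ennreal flip: ennreal_mult)
    also have "\<dots> \<le> ennreal x" using False real c le' by (intro ennreal_leI) (simp add: field_simps)
    finally show ?thesis .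
  qed
next
  case top
  then show ?thesis using c by (simp add: scaled_increment_def ennreal_mult_top divide_ennreal_def)
qed

lemma ext_top_le:
  assumes "mono_on {0..} \<Psi>" "y \<le> ennreal x" "0 \<le> x"
  shows "ext_top \<Psi> y \<le> ennreal (\<Psi> x)"
proof -
  have y: "y \<noteq> \<infinity>" using assms(2) by (auto simp: top_unique)
  then have "enn2real y \<le> x" using assms(2,3) by (cases y) auto
  then have "\<Psi> (enn2real y) \<le> \<Psi> x" using assms by (auto simp: mono_on_def)
  then show ?thesis using y by (simp add: ext_top_def ennreal_leI)
qed

subsection \<open>Packing by balls of prescribed mass\<close>

locale compact_metric_measure = Metric_space T d for T :: "'a set" and d +
  fixes m :: "'a measure"
  assumes compact: "compact_space mtopology"
    and borel: "borel_probability mtopology m"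
begin

sublocale prob_space m
  using borel by (simp add: borel_probability_def)

lemma space_m [simp]: "space m = T"
  using borel by (simp add: borel_probability_def)

lemma open_sets: "openin mtopology U \<Longrightarrow> U \<in> sets m"
  using borel by (simp add: borel_probability_def sigma_sets.Basic)

lemma closed_sets: "closedin mtopology U \<Longrightarrow> U \<in> sets m"
proof -
  assume *: "closedin mtopology U"
  then have "U = space m - (T - U)" using closedin_subset[OF *] by auto
  moreover have "T - U \<in> sets m" using * by (intro open_sets) (auto simp: closedin_def)
  ultimately show ?thesis by (metis sets.compl_sets)
qed

lemma mcball_sets [simp]: "mcball x \<epsilon> \<in> sets m"
  by (intro closed_sets closedin_mcball)

lemma mball_sets [simp]: "mball x \<epsilon> \<in> sets m"
  by (intro open_sets openin_mball)

lemma mcball_everything: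
  obtains D where "0 \<le> D" "\<And>x. x \<in> T \<Longrightarrow> mcball x D = T"
proof -
  have "mbounded T"
    using compact compactin_imp_mbounded[of T] by (simp add: compact_space_def)
  then obtain D where "\<forall>x\<in>T. \<forall>y\<in>T. d x y \<le> D" by (auto simp: mbounded_alt)
  then show ?thesis by (intro that[of "max D 0"]) (auto simp: le_max_iff_disj)
qed

section \<open>Smallest radii of balls of prescribed mass\<close>

definition rad :: "real \<Rightarrow> 'a \<Rightarrow> real" where
  "rad c x = Inf {\<epsilon>. 0 \<le> \<epsilon> \<and> c \<le> measure m (mcball x \<epsilon>)}"

lemma rad_le: "0 \<le> \<epsilon> \<Longrightarrow> c \<le> measure m (mcball x \<epsilon>) \<Longrightarrow> rad c x \<le> \<epsilon>"
  unfolding rad_def by (intro cInf_lower bdd_belowI[of _ 0]) auto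

lemma rad_nonempty:
  assumes "c \<le> 1" "x \<in> T"
  shows "{\<epsilon>. 0 \<le> \<epsilon> \<and> c \<le> measure m (mcball x \<epsilon>)} \<noteq> {}"
proof -
  obtain D where "0 \<le> D" "mcball x D = T" using mcball_everything assms by metis
  then have "0 \<le> D \<and> c \<le> measure m (mcball x D)" using assms prob_space by simp
  then show ?thesis by blast
qed

lemma rad_nonneg: "c \<le> 1 \<Longrightarrow> x \<in> T \<Longrightarrow> 0 \<le> rad c x"
  unfolding rad_def by (intro cInf_greatest rad_nonempty) auto

text \<open>The closed balls of radius \<open>rad c x + 1 / real (Suc n)\<close> decrease to the one
  of radius \<open>rad c x\<close>; continuity from above shows that the infimum is
  attained.\<close>

lemma measure_mcball_rad:
  assumes c: "c \<le> 1" and x: "x \<in> T"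
  shows "c \<le> measure m (mcball x (rad c x))"
proof -
  define A where "A n = mcball x (rad c x + 1 / real (Suc n))" for n
  have rng: "range A \<subseteq> sets m" by (auto simp: A_def)
  have "decseq A"
    unfolding A_def by (intro decseq_SucI mcball_subset_concentric add_left_mono divide_left_mono) auto
  moreover have "(\<Inter>n. A n) = mcball x (rad c x)"
  proof (intro equalityI subsetI)
    fix y assume y: "y \<in> (\<Inter>n. A n)"
    have "(\<lambda>n. rad c x + 1 / real (Suc n)) \<longlonglongrightarrow> rad c x + 0"
      by (intro tendsto_add tendsto_const LIMSEQ_Suc lim_1_over_n)
    then have "d x y \<le> rad c x + 0" by (rule LIMSEQ_le_const) (use y in \<open>auto simp: A_def\<close>)
    then show "y \<in> mcball x (rad c x)" using y by (auto simp: A_def)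
  next
    fix y assume "y \<in> mcball x (rad c x)"
    then show "y \<in> (\<Inter>n. A n)"
      by (auto simp: A_def intro: order.trans[of _ "rad c x"])
  qed
  ultimately have "(\<lambda>n. measure m (A n)) \<longlonglongrightarrow> measure m (mcball x (rad c x))"
    using finite_Lim_measure_decseq[of A] rng by simp
  moreover have "c \<le> measure m (A n)" for n
  proof -
    have "rad c x < rad c x + 1 / real (Suc n)" by simp
    then obtain \<epsilon> where "c \<le> measure m (mcball x \<epsilon>)" "\<epsilon> < rad c x + 1 / real (Suc n)"
      unfolding rad_def using cInf_lessD[OF rad_nonempty[OF c x]] by blast
    moreover from this(2) have "measure m (mcball x \<epsilon>) \<le> measure m (A n)"
      unfolding A_def by (intro finite_measure_mono mcball_subset_concentric) auto
    ultimately show ?thesis by simp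
  qed
  ultimately show ?thesis by (intro LIMSEQ_le_const) auto
qed

lemma measure_mcball_less:
  assumes "0 < c" "\<epsilon> < rad c x"
  shows "measure m (mcball x \<epsilon>) < c"
proof (cases "0 \<le> \<epsilon>")
  case True
  then show ?thesis using rad_le[of \<epsilon> c x] assms by force
next
  case False
  then have "mcball x \<epsilon> = {}" by (simp add: mcball_eq_empty)
  then show ?thesis using assms by simp
qed

text \<open>The open ball is an increasing union of closed balls of radius below
  \<open>rad c x\<close>, each of mass less than \<open>c\<close>. This upper bound drives the count
  of close pairs.\<close>

lemma measure_mball_rad:
  assumes c: "0 < c"
  shows "measure m (mball x (rad c x)) \<le> c"
proof -
  define A where "A n = mcball x (rad c x - 1 / real (Suc n))" for n
  have rng: "range A \<subseteq> sets m" by (auto simp: A_def)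
  have "incseq A"
    unfolding A_def by (intro incseq_SucI mcball_subset_concentric diff_left_mono divide_left_mono) auto
  moreover have "(\<Union>n. A n) = mball x (rad c x)"
  proof (intro equalityI subsetI)
    fix y assume "y \<in> (\<Union>n. A n)"
    then obtain n where n: "x \<in> T" "y \<in> T" "d x y \<le> rad c x - 1 / real (Suc n)"
      by (auto simp: A_def)
    moreover have "rad c x - 1 / real (Suc n) < rad c x" by simp
    ultimately have "d x y < rad c x" by (rule_tac order.strict_trans1)
    then show "y \<in> mball x (rad c x)" using n by simp
  next
    fix y assume y: "y \<in> mball x (rad c x)"
    then obtain n where "inverse (real (Suc n)) < rad c x - d x y"
      using reals_Archimedean[of "rad c x - d x y"] by auto
    then have "y \<in> A n" using y by (auto simp: A_def field_simps)
    then show "y \<in> (\<Union>n. A n)" by blast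
  qed
  ultimately have "(\<lambda>n. measure m (A n)) \<longlonglongrightarrow> measure m (mball x (rad c x))"
    using finite_Lim_measure_incseq[of A] rng by simp
  moreover have "measure m (A n) \<le> c" for n
    unfolding A_def by (intro less_imp_le measure_mcball_less c) simp
  ultimately show ?thesis by (intro LIMSEQ_le_const2) auto
qed

lemma rad_lipschitz:
  assumes "c \<le> 1" "x \<in> T" "y \<in> T"
  shows "rad c y \<le> rad c x + d x y"
proof (rule rad_le)
  have "c \<le> measure m (mcball x (rad c x))" using assms by (intro measure_mcball_rad)
  also have "\<dots> \<le> measure m (mcball y (rad c x + d x y))"
    using assms by (intro finite_measure_mono mcball_subset) auto
  finally show "c \<le> measure m (mcball y (rad c x + d x y))" .
qed (use assms rad_nonneg[of c x] in auto)

text \<open>By the triangle inequality the balls \<open>mcball x (rad c x)\<close> are then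
  disjoint, and the negation of the condition is the distance bound that a net needs.\<close>

definition separated :: "real \<Rightarrow> 'a set \<Rightarrow> bool" where
  "separated c F \<longleftrightarrow> (\<forall>x\<in>F. \<forall>y\<in>F. x \<noteq> y \<longrightarrow> rad c x + rad c y < d x y)"

text \<open>The balls are disjoint, of mass at least \<open>c\<close>, and all lie in
  \<open>A\<close>. With \<open>A\<close> the whole space this bounds nets, with \<open>A\<close> an
  open ball it bounds close pairs.\<close>

lemma separated_card_le:
  assumes c: "0 < c" "c \<le> 1" and F: "finite F" "F \<subseteq> T" "separated c F"
    and A: "A \<in> sets m" "\<And>x. x \<in> F \<Longrightarrow> mcball x (rad c x) \<subseteq> A"
  shows "real (card F) * c \<le> measure m A"
proof -
  have disj: "disjoint_family_on (\<lambda>x. mcball x (rad c x)) F"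
    unfolding disjoint_family_on_def
  proof (intro ballI impI equals0I)
    fix x y z assume xy: "x \<in> F" "y \<in> F" "x \<noteq> y"
      and z: "z \<in> mcball x (rad c x) \<inter> mcball y (rad c y)"
    have "d x y \<le> d x z + d z y" using xy z F by (intro triangle) auto
    moreover have "d z y = d y z" by (rule commute)
    ultimately show False using xy z F(3) unfolding separated_def by force
  qed
  have "real (card F) * c = (\<Sum>x\<in>F. c)" by simp
  also have "\<dots> \<le> (\<Sum>x\<in>F. measure m (mcball x (rad c x)))"
    using c F by (intro sum_mono measure_mcball_rad) auto
  also have "\<dots> = measure m (\<Union>x\<in>F. mcball x (rad c x))"
    using F disj by (intro finite_measure_finite_Union[symmetric]) auto
  also have "\<dots> \<le> measure m A" using A by (intro finite_measure_mono) auto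
  finally show ?thesis .
qed

text \<open>Every finite subset has at most \<open>1 / c\<close> points, so an infinite set would
  contain a finite one that is too large.\<close>

lemma separated_finite:
  assumes c: "0 < c" "c \<le> 1" and F: "F \<subseteq> T" "separated c F"
  shows "finite F" and "real (card F) * c \<le> 1"
proof -
  have bd: "real (card G) * c \<le> 1" if "G \<subseteq> F" "finite G" for G
  proof -
    have "separated c G" "G \<subseteq> T" using F that by (auto simp: separated_def)
    then have "real (card G) * c \<le> measure m T"
      using that mcball_subset_mspace sets.top[of m] by (intro separated_card_le c) auto
    then show ?thesis using prob_space by simp
  qed
  show "finite F"
  proof (rule ccontr)
    assume "infinite F"
    then obtain G where "finite G" "card G = nat \<lfloor>1 / c\<rfloor> + 1" "G \<subseteq> F"
      using infinite_arbitrarily_large by blast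
    then have "(real (nat \<lfloor>1 / c\<rfloor>) + 1) * c \<le> 1" using bd[of G] by (simp add: add.commute)
    moreover have "1 / c < real (nat \<lfloor>1 / c\<rfloor>) + 1"
      using c real_of_int_floor_add_one_gt[of "1 / c"] by simp
    ultimately show False using c by (simp add: field_simps)
  qed
  then show "real (card F) * c \<le> 1" using bd by simp
qed

text \<open>Greedy selection, by induction on a bound for the size of separated subsets. A discarded
  point \<open>y\<close> lies within \<open>rad c y + rad c x\<close> of a selected \<open>x\<close>
  whose radius is at most twice its own, hence within \<open>3 * rad c y\<close>.\<close>

lemma separated_net_positive:
  assumes c: "0 < c" "c \<le> 1" and \<eta>: "0 < \<eta>" 
  shows "G \<subseteq> T \<Longrightarrow> (\<And>x. x \<in> G \<Longrightarrow> \<eta> \<le> rad c x) \<Longrightarrow>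
    (\<And>F. F \<subseteq> G \<Longrightarrow> separated c F \<Longrightarrow> card F \<le> n) \<Longrightarrow>
    \<exists>N\<subseteq>G. separated c N \<and> (\<forall>x\<in>G. \<exists>y\<in>N. d x y \<le> rad c x + rad c y \<and> rad c y \<le> 2 * rad c x)"
proof (induction n arbitrary: G)
  case 0
  have "x \<notin> G" for x
    using 0(3)[of "{x}"] by (auto simp: separated_def)
  then show ?case by (intro exI[of _ "{}"]) (auto simp: separated_def)
next
  case (Suc n)
  show ?case
  proof (cases "G = {}")
    case True
    then show ?thesis by (intro exI[of _ "{}"]) (auto simp: separated_def)
  next
    case False
    \<comment> \<open>The infimum need not be attained; since \<open>\<eta>\<close> keeps it
      positive, some radius is below twice the infimum.\<close>
    define i where "i = Inf (rad c ` G)"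
    have "\<eta> \<le> i" unfolding i_def using False Suc.prems by (intro cInf_greatest) auto
    then have "i < 2 * i" using \<eta> by simp
    then have "\<exists>z\<in>rad c ` G. z < 2 * i"
      using cInf_lessD[of "rad c ` G" "2 * i"] False unfolding i_def by blast
    then obtain x where x: "x \<in> G" "rad c x < 2 * i" by blast
    have min: "rad c x \<le> 2 * rad c y" if "y \<in> G" for y
    proof -
      have "i \<le> rad c y" unfolding i_def using that Suc.prems(2)
        by (intro cInf_lower bdd_belowI[of _ \<eta>]) auto
      then show ?thesis using x by simp
    qed
    \<comment> \<open>Adding \<open>x\<close> to a separated subset of \<open>G'\<close> gives a
      separated subset of \<open>G\<close>, so the cardinality bound drops by one.\<close>
    define G' where "G' = {y\<in>G. rad c x + rad c y < d x y}"
    have x0: "x \<notin> G'" "d x x = 0"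
      using x Suc.prems(1) rad_nonneg[of c x] c by (auto simp: G'_def)
    have "\<exists>N\<subseteq>G'. separated c N \<and>
        (\<forall>x\<in>G'. \<exists>y\<in>N. d x y \<le> rad c x + rad c y \<and> rad c y \<le> 2 * rad c x)"
    proof (rule Suc.IH)
      fix F assume F: "F \<subseteq> G'" "separated c F"
      have "separated c (insert x F)"
        using F by (auto simp: separated_def G'_def commute add.commute subset_iff)
      moreover have "insert x F \<subseteq> G" using F x by (auto simp: G'_def)
      ultimately have "card (insert x F) \<le> Suc n" by (intro Suc.prems)
      moreover have "finite F"
        using F Suc.prems(1) by (intro separated_finite(1)[OF c]) (auto simp: G'_def)
      moreover have "x \<notin> F" using F x0 by auto
      ultimately show "card F \<le> n" by simp
    qed (use Suc.prems in \<open>auto simp: G'_def\<close>)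
    then obtain N where N: "N \<subseteq> G'" "separated c N"
      "\<And>x. x \<in> G' \<Longrightarrow> \<exists>y\<in>N. d x y \<le> rad c x + rad c y \<and> rad c y \<le> 2 * rad c x" by blast
    show ?thesis
    proof (intro exI[of _ "insert x N"] conjI ballI)
      show "insert x N \<subseteq> G" using N x by (auto simp: G'_def)
      show "separated c (insert x N)"
        using N by (auto simp: separated_def G'_def commute add.commute subset_iff)
      fix y assume y: "y \<in> G"
      show "\<exists>z\<in>insert x N. d y z \<le> rad c y + rad c z \<and> rad c z \<le> 2 * rad c y"
      proof (cases "y \<in> G'")
        case False
        then have "d y x \<le> rad c y + rad c x"
          using y commute[of y x] by (auto simp: G'_def)
        then show ?thesis using min[OF y] by auto
      qed (use N in blast)
    qed
  qed
qed

text \<open>A point at which \<open>rad c\<close> vanishes is an atom, so it has a neighbourhood in which the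
  balls that avoid it have mass less than \<open>c\<close>.\<close>

lemma rad_bounded_below:
  assumes c: "0 < c" "c \<le> 1"
    and G: "G = {x\<in>T. \<forall>z\<in>T. rad c z = 0 \<longrightarrow> rad c x < d x z}"
  shows "\<exists>\<eta>>0. \<forall>x\<in>G. \<eta> \<le> rad c x"
proof (rule ccontr)
  assume "\<not> ?thesis"
  then have "\<exists>x\<in>G. rad c x < 1 / real (Suc n)" for n
    by (metis not_le of_nat_0_less_iff zero_less_Suc zero_less_divide_1_iff)
  then obtain \<sigma> where \<sigma>: "\<And>n. \<sigma> n \<in> G" "\<And>n. rad c (\<sigma> n) < 1 / real (Suc n)" by metis
  then have "range \<sigma> \<subseteq> T" using G by auto
  then obtain x \<rho> where x: "x \<in> T" and \<rho>: "strict_mono \<rho>" "limitin mtopology (\<sigma> \<circ> \<rho>) x sequentially"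
    using compact unfolding compact_space_sequentially by blast
  \<comment> \<open>Balls of mass at least \<open>c\<close> thus fit into every ball around the
    limit \<open>x\<close>, which forces \<open>rad c x = 0\<close>.\<close>
  have near: "\<exists>n. mcball (\<sigma> n) (rad c (\<sigma> n)) \<subseteq> mcball x \<epsilon>" if \<epsilon>: "0 < \<epsilon>" for \<epsilon>
  proof -
    obtain n0 where n0: "\<And>n. n \<ge> n0 \<Longrightarrow> d (\<sigma> (\<rho> n)) x < \<epsilon> / 2"
      using \<rho>(2) \<epsilon> unfolding limit_metric_sequentially by (fastforce dest: spec[of _ "\<epsilon> / 2"])
    obtain n1 :: nat where n1: "2 / \<epsilon> < real n1" using reals_Archimedean2 by blast
    define n where "n = max n0 n1"
    have "real n1 \<le> real (Suc (\<rho> n))"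
      using seq_suble[OF \<rho>(1), of n] by (simp add: n_def)
    then have "2 / \<epsilon> < real (Suc (\<rho> n))" using n1 by linarith
    then have "1 / real (Suc (\<rho> n)) \<le> \<epsilon> / 2"
      using \<epsilon> by (simp add: field_simps)
    then have "rad c (\<sigma> (\<rho> n)) \<le> \<epsilon> / 2" using \<sigma>(2)[of "\<rho> n"] by simp
    moreover have "d (\<sigma> (\<rho> n)) x < \<epsilon> / 2" by (rule n0) (simp add: n_def)
    ultimately show ?thesis using x by (intro exI[of _ "\<rho> n"] mcball_subset) auto
  qed
  have inG: "\<sigma> n \<in> T" for n using \<sigma>(1)[of n] G by auto
  have "rad c x \<le> \<epsilon>" if \<epsilon>: "0 < \<epsilon>" for \<epsilon>
  proof (rule rad_le)
    obtain n where n: "mcball (\<sigma> n) (rad c (\<sigma> n)) \<subseteq> mcball x \<epsilon>" using near[OF \<epsilon>] ..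
    have "c \<le> measure m (mcball (\<sigma> n) (rad c (\<sigma> n)))" by (intro measure_mcball_rad c inG)
    also have "\<dots> \<le> measure m (mcball x \<epsilon>)" using n by (intro finite_measure_mono) auto
    finally show "c \<le> measure m (mcball x \<epsilon>)" .
  qed (use \<epsilon> in simp)
  then have "rad c x \<le> 0" by (rule field_le_epsilon) simp
  then have rx: "rad c x = 0" using rad_nonneg[of c x] c x by simp
  define A where "A n = mcball x (1 / real (Suc n)) - {x}" for n
  have "y = x" if "y \<in> mcball x 0" for y
    using that nonneg[of x y] zero[of x y] by (simp add: order.antisym)
  then have "mcball x 0 = {x}" using x by auto
  then have sing: "{x} \<in> sets m" using mcball_sets[of x 0] by simp
  have Asets: "A n \<in> sets m" for n unfolding A_def using sing by (intro sets.Diff) auto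
  have "decseq A"
    unfolding A_def by (intro decseq_SucI Diff_mono mcball_subset_concentric divide_left_mono) auto
  moreover have "(\<Inter>n. A n) = {}"
  proof (intro equals0I)
    fix y assume y: "y \<in> (\<Inter>n. A n)"
    have "(\<lambda>n. 1 / real (Suc n)) \<longlonglongrightarrow> 0" by (intro LIMSEQ_Suc lim_1_over_n)
    then have "d x y \<le> 0" by (rule LIMSEQ_le_const) (use y in \<open>auto simp: A_def\<close>)
    moreover have "y \<in> T" "y \<noteq> x" using y by (auto simp: A_def)
    ultimately show False using x by (metis nonneg zero order.antisym)
  qed
  ultimately have "(\<lambda>n. measure m (A n)) \<longlonglongrightarrow> 0"
    using finite_Lim_measure_decseq[of A] Asets by auto
  moreover have "c \<le> measure m (A n)" for n
  proof -
    obtain k where k: "mcball (\<sigma> k) (rad c (\<sigma> k)) \<subseteq> mcball x (1 / real (Suc n))"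
      using near[of "1 / real (Suc n)"] by auto
    have "x \<notin> mcball (\<sigma> k) (rad c (\<sigma> k))" using \<sigma>(1)[of k] x rx by (auto simp: G)
    then have "mcball (\<sigma> k) (rad c (\<sigma> k)) \<subseteq> A n" using k by (auto simp: A_def)
    then have "measure m (mcball (\<sigma> k) (rad c (\<sigma> k))) \<le> measure m (A n)"
      by (intro finite_measure_mono Asets)
    then show ?thesis using measure_mcball_rad[of c "\<sigma> k"] c inG by force
  qed
  ultimately have "c \<le> 0" by (intro LIMSEQ_le_const) auto
  then show False using c by simp
qed

text \<open>All points of vanishing radius are kept, as \<open>Z\<close>, and serve every
  \<open>x\<close> that has one of them within \<open>rad c x\<close>. The remaining points form
  \<open>G\<close>, where radii are bounded below and greedy selection applies; the definition of
  \<open>G\<close> separates the selected points from \<open>Z\<close>.\<close>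

lemma separated_net:
  assumes c: "0 < c" "c \<le> 1"
  shows "\<exists>N\<subseteq>T. separated c N \<and> (\<forall>x\<in>T. \<exists>y\<in>N. d x y \<le> 3 * rad c x)"
proof -
  define Z where "Z = {z\<in>T. rad c z = 0}"
  define G where "G = {x\<in>T. \<forall>z\<in>T. rad c z = 0 \<longrightarrow> rad c x < d x z}"
  obtain \<eta> where \<eta>: "0 < \<eta>" "\<And>x. x \<in> G \<Longrightarrow> \<eta> \<le> rad c x"
    using rad_bounded_below[OF c G_def] by blast
  have "\<exists>N\<subseteq>G. separated c N \<and> (\<forall>x\<in>G. \<exists>y\<in>N. d x y \<le> rad c x + rad c y \<and> rad c y \<le> 2 * rad c x)"
  proof (rule separated_net_positive[OF c \<eta>(1)])
    show "G \<subseteq> T" by (auto simp: G_def)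
    fix F assume "F \<subseteq> G" "separated c F"
    then have "real (card F) \<le> 1 / c" using \<open>G \<subseteq> T\<close> separated_finite(2)[OF c, of F] c
      by (auto simp: field_simps)
    then show "card F \<le> nat \<lfloor>1 / c\<rfloor>" by (simp add: le_nat_floor)
  qed (use \<eta> in auto)
  then obtain N where N: "N \<subseteq> G" "separated c N"
    "\<And>x. x \<in> G \<Longrightarrow> \<exists>y\<in>N. d x y \<le> rad c x + rad c y \<and> rad c y \<le> 2 * rad c x" by blast
  show ?thesis
  proof (intro exI[of _ "Z \<union> N"] conjI ballI)
    show "Z \<union> N \<subseteq> T" using N by (auto simp: Z_def G_def)
    have "0 < d x y" if "x \<in> T" "y \<in> T" "x \<noteq> y" for x y
      using that mdist_pos_less by blast
    moreover have "rad c x < d x z \<and> rad c x < d z x" if "x \<in> N" "z \<in> Z" for x z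
      unfolding commute[of z x] using N(1) that by (auto simp: Z_def G_def)
    ultimately show "separated c (Z \<union> N)"
      using N(2) by (auto simp: separated_def Z_def)
    fix x assume x: "x \<in> T"
    show "\<exists>y\<in>Z \<union> N. d x y \<le> 3 * rad c x"
    proof (cases "x \<in> G")
      case True
      then show ?thesis using N(3)[OF True] by force
    next
      case False
      then obtain z where "z \<in> Z" "d x z \<le> rad c x" using x by (force simp: G_def Z_def)
      then show ?thesis using rad_nonneg[OF c(2) x] by force
    qed
  qed
qed

end

subsection \<open>Chaining\<close>

text \<open>Solves \<open>e\<^sub>j = 3 \<rho>\<^sub>j + 4 e\<^sub>j\<^sub>+\<^sub>1\<close>: a point at distance \<open>e\<close> from \<open>x\<close> moves by at most
  \<open>3 (\<rho>\<^sub>j + e)\<close> under the projection, the radii being Lipschitz.\<close>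

definition drift :: "(nat \<Rightarrow> real) \<Rightarrow> nat \<Rightarrow> nat \<Rightarrow> real" where
  "drift \<rho> n j = 3 * (\<Sum>i=j..n. 4 ^ (i - j) * \<rho> i)"

lemma drift_last [simp]: "drift \<rho> n n = 3 * \<rho> n"
  by (simp add: drift_def)

lemma drift_step:
  assumes "j < n"
  shows "drift \<rho> n j = 3 * \<rho> j + 4 * drift \<rho> n (Suc j)"
proof -
  have "(\<Sum>i=j..n. 4 ^ (i - j) * \<rho> i) = \<rho> j + (\<Sum>i=Suc j..n. 4 ^ (i - j) * \<rho> i)"
    using assms by (subst sum.atLeast_Suc_atMost) auto
  also have "(\<Sum>i=Suc j..n. 4 ^ (i - j) * \<rho> i) = 4 * (\<Sum>i=Suc j..n. 4 ^ (i - Suc j) * \<rho> i)"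
    by (subst sum_distrib_left, intro sum.cong)
      (auto simp: Suc_diff_le Suc_diff_Suc simp flip: power_Suc mult.assoc)
  finally show ?thesis by (simp add: drift_def)
qed

lemma drift_nonneg: "(\<And>i. 0 \<le> \<rho> i) \<Longrightarrow> 0 \<le> drift \<rho> n j"
  by (auto simp: drift_def intro!: sum_nonneg)

text \<open>In the induction the drift at level \<open>l\<close> occurs twice, in the sum and as
  boundary term, which gives \<open>6 * (R ^ l * \<rho> l) + 8 * e\<close>. For
  \<open>R \<ge> 8\<close> the second part is covered by the boundary term \<open>R * e\<close> of
  the next level.\<close>

lemma drift_sum_le:
  fixes R :: real
  assumes \<rho>: "\<And>i. 0 \<le> \<rho> i" and R: "8 \<le> R" and "l \<le> n"
  shows "(\<Sum>j=l..<n. R ^ j * drift \<rho> n j) + R ^ l * drift \<rho> n l \<le> 6 * (\<Sum>i=l..n. R ^ i * \<rho> i)"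
  using \<open>l \<le> n\<close>
proof (induction l rule: inc_induct)
  case base
  show ?case using \<rho>[of n] R by simp
next
  case (step l)
  define e where "e = R ^ l * drift \<rho> n (Suc l)"
  have e: "0 \<le> e" using R drift_nonneg[OF \<rho>] by (simp add: e_def)
  have "(\<Sum>j=l..<n. R ^ j * drift \<rho> n j)
      = R ^ l * drift \<rho> n l + (\<Sum>j=Suc l..<n. R ^ j * drift \<rho> n j)"
    using step by (subst sum.atLeast_Suc_lessThan) auto
  moreover have "R ^ l * drift \<rho> n l = 3 * (R ^ l * \<rho> l) + 4 * e"
    unfolding drift_step[OF step(2)] e_def by (simp add: algebra_simps)
  moreover have "R ^ Suc l * drift \<rho> n (Suc l) = R * e" by (simp add: e_def)
  moreover have "8 * e \<le> R * e" using e R by (intro mult_right_mono)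
  moreover have "(\<Sum>i=l..n. R ^ i * \<rho> i) = R ^ l * \<rho> l + (\<Sum>i=Suc l..n. R ^ i * \<rho> i)"
    using step by (subst sum.atLeast_Suc_atMost) auto
  ultimately show ?case using step.IH by linarith
qed

text \<open>\<open>a 0 = 1\<close> leaves at most one point in the coarsest net, and log-convexity
  bounds the close pairs. The 44 is twice the factor 22 by which the distance bound for two chains
  can grow in one step of \<open>chains_meet\<close>.\<close>

locale metric_chaining = compact_metric_measure T d m
  for T :: "'a set" and d and m :: "'a measure" +
  fixes a :: "nat \<Rightarrow> real" and R :: real
  assumes a_0: "a 0 = 1" and a_ge_1: "\<And>k. 1 \<le> a k" and a_mono: "\<And>k. a k \<le> a (Suc k)"
    and a_log_convex: "\<And>k. (a (Suc k))\<^sup>2 \<le> a k * a (Suc (Suc k))"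
    and R_ge: "44 \<le> R"
begin

abbreviation radius :: "nat \<Rightarrow> 'a \<Rightarrow> real" where
  "radius k \<equiv> rad (1 / a k)"

lemma a_pos: "0 < a k"
  using a_ge_1[of k] by linarith

lemma a_inverse: "0 < 1 / a k" "1 / a k \<le> 1"
  using a_pos[of k] a_ge_1[of k] by auto

section \<open>Nets, projections and links\<close>

definition net :: "nat \<Rightarrow> 'a set" where
  "net k = (SOME N. N \<subseteq> T \<and> separated (1 / a k) N \<and> (\<forall>x\<in>T. \<exists>y\<in>N. d x y \<le> 3 * radius k x))"

lemma net: "net k \<subseteq> T" "separated (1 / a k) (net k)"
  "x \<in> T \<Longrightarrow> \<exists>y\<in>net k. d x y \<le> 3 * radius k x"
  using someI_ex[OF separated_net[OF a_inverse], folded net_def] by auto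

lemma finite_net [simp]: "finite (net k)"
  by (rule separated_finite(1)[OF a_inverse net(1,2)])

lemma card_net: "real (card (net k)) \<le> a k"
  using separated_finite(2)[OF a_inverse net(1,2), of k] a_pos[of k] by (simp add: field_simps)

definition proj :: "nat \<Rightarrow> 'a \<Rightarrow> 'a" where
  "proj k x = (SOME y. y \<in> net k \<and> d x y \<le> 3 * radius k x)"

lemma proj: "x \<in> T \<Longrightarrow> proj k x \<in> net k" "x \<in> T \<Longrightarrow> d x (proj k x) \<le> 3 * radius k x"
  using someI_ex[of "\<lambda>y. y \<in> net k \<and> d x y \<le> 3 * radius k x"] net(3)[of x k]
  unfolding proj_def by auto

lemma proj_in [simp]: "x \<in> T \<Longrightarrow> proj k x \<in> T"
  using proj(1) net(1) by blast

text \<open>The admissible jumps between two chains. Containment of balls is what the packing count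
  uses, and the outer ball is open because \<open>measure_mball_rad\<close> bounds the mass of open
  balls.\<close>

definition close_pairs :: "nat \<Rightarrow> ('a \<times> 'a) set" where
  "close_pairs k = (SIGMA u:net (Suc k).
     {v\<in>net (Suc k). mcball v (radius (Suc k) v) \<subseteq> mball u (radius k u)})"

text \<open>A link of level \<open>k\<close> starts in \<open>net (Suc k)\<close>, but its length is
  governed by \<open>radius k\<close>; hence the slope \<open>R ^ k\<close> is attached to
  it.\<close>

definition links :: "nat \<Rightarrow> ('a \<times> 'a) set" where
  "links k = (\<lambda>u. (u, proj k u)) ` net (Suc k) \<union> close_pairs k"

lemma links_subset: "links k \<subseteq> T \<times> T"
  using net(1) proj_in by (auto simp: links_def close_pairs_def subset_iff)

lemma finite_links [simp]: "finite (links k)"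
  by (auto simp: links_def close_pairs_def)

text \<open>The balls around the partners of \<open>u\<close> are disjoint, of mass at least \<open>1 / a (Suc k)\<close>, and
  packed into an open ball of mass at most \<open>1 / a k\<close>.\<close>

lemma card_close_pairs: "real (card (close_pairs k)) \<le> a (Suc (Suc k))"
proof -
  define P where "P u = {v\<in>net (Suc k). mcball v (radius (Suc k) v) \<subseteq> mball u (radius k u)}" for u
  have P: "real (card (P u)) \<le> a (Suc k) / a k" if "u \<in> net (Suc k)" for u
  proof -
    have "separated (1 / a (Suc k)) (P u)" "P u \<subseteq> T"
      using net(1,2)[of "Suc k"] by (auto simp: P_def separated_def)
    then have "real (card (P u)) * (1 / a (Suc k)) \<le> measure m (mball u (radius k u))"
      by (intro separated_card_le a_inverse) (auto simp: P_def)
    also have "\<dots> \<le> 1 / a k" by (intro measure_mball_rad a_inverse)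
    finally show ?thesis using a_pos[of k] a_pos[of "Suc k"] by (simp add: field_simps)
  qed
  have "card (close_pairs k) = (\<Sum>u\<in>net (Suc k). card (P u))"
    unfolding close_pairs_def P_def by (intro card_SigmaI) auto
  then have "real (card (close_pairs k)) = (\<Sum>u\<in>net (Suc k). real (card (P u)))" by simp
  also have "\<dots> \<le> (\<Sum>u\<in>net (Suc k). a (Suc k) / a k)" by (intro sum_mono P)
  also have "\<dots> \<le> a (Suc k) * (a (Suc k) / a k)"
    using card_net[of "Suc k"] a_pos[of k] a_pos[of "Suc k"]
    by (simp add: mult_right_mono divide_right_mono)
  also have "\<dots> \<le> a (Suc (Suc k))"
    using a_log_convex[of k] a_pos[of k] by (simp add: field_simps power2_eq_square)
  finally show ?thesis .
qed

lemma card_links: "real (card (links k)) \<le> 2 * a (Suc (Suc k))"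
proof -
  have "card (links k) \<le> card (net (Suc k)) + card (close_pairs k)"
    unfolding links_def by (intro order.trans[OF card_Un_le] add_mono card_image_le) auto
  then show ?thesis
    using card_net[of "Suc k"] card_close_pairs[of k] a_mono[of "Suc k"] by linarith
qed

text \<open>The coarsest net has at most \<open>a 0 = 1\<close> points, so all chains end in the
  same point; this starts the induction in \<open>chains_meet\<close>.\<close>

lemma net_0: "u \<in> net 0 \<Longrightarrow> v \<in> net 0 \<Longrightarrow> u = v"
  using card_net[of 0] a_0 card_le_Suc0_iff_eq[of "net 0"] by simp

section \<open>Chains of successive projections\<close>

definition chain :: "nat \<Rightarrow> 'a \<Rightarrow> (nat \<Rightarrow> 'a) \<Rightarrow> bool" where
  "chain n x p \<longleftrightarrow> p n = proj n x \<and> (\<forall>j<n. p j = proj j (p (Suc j)))"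

lemma chain_exists: "\<exists>p. chain n x p"
proof -
  have "\<exists>p. p n = y \<and> (\<forall>j<n. p j = proj j (p (Suc j)))" for y
  proof (induction n arbitrary: y)
    case (Suc n)
    obtain p where "p n = proj n y" "\<forall>j<n. p j = proj j (p (Suc j))" using Suc by blast
    then show ?case by (intro exI[of _ "p(Suc n := y)"]) (auto simp: less_Suc_eq)
  qed auto
  then show ?thesis by (auto simp: chain_def)
qed

lemma radius_nonneg: "x \<in> T \<Longrightarrow> 0 \<le> radius k x"
  by (rule rad_nonneg[OF a_inverse(2)])

lemma radius_lipschitz: "x \<in> T \<Longrightarrow> y \<in> T \<Longrightarrow> radius k y \<le> radius k x + d x y"
  by (rule rad_lipschitz[OF a_inverse(2)])

abbreviation rdrift :: "nat \<Rightarrow> 'a \<Rightarrow> nat \<Rightarrow> real" where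
  "rdrift n x \<equiv> drift (\<lambda>i. radius i x) n"

lemma rdrift_nonneg: "x \<in> T \<Longrightarrow> 0 \<le> rdrift n x j"
  by (intro drift_nonneg radius_nonneg)

context
  fixes n x p
  assumes x: "x \<in> T" and p: "chain n x p"
begin

text \<open>The projection to level \<open>j\<close> moves a point by at most three times its
  radius, which exceeds the radius at \<open>x\<close> by at most the distance drifted so far; this
  is the recursion of \<open>drift_step\<close>.\<close>

lemma chain_near:
  assumes "j \<le> n"
  shows "p j \<in> net j \<and> p j \<in> T \<and> d x (p j) \<le> rdrift n x j"
  using assms
proof (induction j rule: inc_induct)
  case base
  then show ?case using p proj[OF x, of n] x by (simp add: chain_def)
next
  case (step j)
  have pj: "p j = proj j (p (Suc j))" using p step(2) by (simp add: chain_def)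
  have T: "p (Suc j) \<in> T" using step by simp
  have "d x (p j) \<le> d x (p (Suc j)) + d (p (Suc j)) (p j)"
    using x T pj by (intro triangle) auto
  moreover have "d (p (Suc j)) (p j) \<le> 3 * radius j (p (Suc j))"
    unfolding pj by (rule proj(2)[OF T])
  moreover have "radius j (p (Suc j)) \<le> radius j x + d x (p (Suc j))"
    by (rule radius_lipschitz[OF x T])
  ultimately have "d x (p j) \<le> rdrift n x j"
    using step.IH unfolding drift_step[OF step(2)] by linarith
  then show ?case using proj(1)[OF T, of j] T by (simp add: pj)
qed

lemma chain_step:
  assumes "j < n"
  shows "(p (Suc j), p j) \<in> links j" "d (p (Suc j)) (p j) \<le> rdrift n x j"
proof -
  have pj: "p j = proj j (p (Suc j))" using p assms by (simp add: chain_def)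
  have near: "p (Suc j) \<in> net (Suc j)" "p (Suc j) \<in> T" "d x (p (Suc j)) \<le> rdrift n x (Suc j)"
    using chain_near[of "Suc j"] assms by auto
  show "(p (Suc j), p j) \<in> links j" using near pj by (auto simp: links_def)
  have "d (p (Suc j)) (p j) \<le> 3 * radius j (p (Suc j))"
    unfolding pj by (rule proj(2)[OF near(2)])
  moreover have "radius j (p (Suc j)) \<le> radius j x + d x (p (Suc j))"
    by (rule radius_lipschitz[OF x near(2)])
  ultimately show "d (p (Suc j)) (p j) \<le> rdrift n x j"
    using near(3) rdrift_nonneg[OF x, of n "Suc j"] unfolding drift_step[OF assms] by linarith
qed

end

context
  fixes f :: "'a \<Rightarrow> real" and \<Lambda> :: real
  assumes \<Lambda>: "0 \<le> \<Lambda>"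
    and f: "\<And>k u v. (u, v) \<in> links k \<Longrightarrow> \<bar>f u - f v\<bar> \<le> \<Lambda> * R ^ k * d u v"
begin

lemma f_link:
  assumes "(u, v) \<in> links k" "d u v \<le> b"
  shows "\<bar>f u - f v\<bar> \<le> \<Lambda> * (R ^ k * b)"
proof -
  have "\<bar>f u - f v\<bar> \<le> \<Lambda> * R ^ k * d u v" by (rule f[OF assms(1)])
  also have "\<dots> \<le> \<Lambda> * R ^ k * b" using assms \<Lambda> R_ge by (intro mult_left_mono) auto
  finally show ?thesis by (simp add: mult.assoc)
qed

lemma chain_increment:
  assumes x: "x \<in> T" and p: "chain n x p" and "l \<le> n"
  shows "\<bar>f (p n) - f (p l)\<bar> \<le> \<Lambda> * (\<Sum>j=l..<n. R ^ j * rdrift n x j)"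
  using \<open>l \<le> n\<close>
proof (induction l rule: inc_induct)
  case (step l)
  have "\<bar>f (p (Suc l)) - f (p l)\<bar> \<le> \<Lambda> * (R ^ l * rdrift n x l)"
    using chain_step[OF x p step(2)] by (rule f_link)
  moreover have "(\<Sum>j=l..<n. R ^ j * rdrift n x j)
      = R ^ l * rdrift n x l + (\<Sum>j=Suc l..<n. R ^ j * rdrift n x j)"
    using step by (subst sum.atLeast_Suc_lessThan) auto
  ultimately show ?case using step.IH by (simp add: distrib_left)
qed simp

text \<open>If the two chains are close on the scale of the next larger ball, then their points form a
  close pair; otherwise the next radius is comparable to the present distance and the chains can
  move on to the next level at a geometrically smaller cost.\<close>

lemma chains_meet:
  assumes s: "s \<in> T" and p: "chain n s p" and t: "t \<in> T" and q: "chain n t q" and "l \<le> n"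
  shows "\<bar>f (p l) - f (q l)\<bar> \<le> \<Lambda> * (R ^ l * (d s t + rdrift n s l + rdrift n t l))"
  using \<open>l \<le> n\<close>
proof (induction l)
  case 0
  have "p 0 = q 0" using chain_near[OF s p] chain_near[OF t q] by (intro net_0) auto
  then show ?case using \<Lambda> rdrift_nonneg[OF s] rdrift_nonneg[OF t] by simp
next
  case (Suc l)
  define Y where "Y k = d s t + rdrift n s k + rdrift n t k" for k
  have ln: "l < n" using Suc by simp
  have near_s: "p (Suc l) \<in> net (Suc l)" "p (Suc l) \<in> T" "d s (p (Suc l)) \<le> rdrift n s (Suc l)"
    using chain_near[OF s p Suc.prems] by auto
  have near_t: "q (Suc l) \<in> net (Suc l)" "q (Suc l) \<in> T" "d t (q (Suc l)) \<le> rdrift n t (Suc l)"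
    using chain_near[OF t q Suc.prems] by auto
  have "d (p (Suc l)) (q (Suc l)) \<le> d (p (Suc l)) s + d s (q (Suc l))"
    "d s (q (Suc l)) \<le> d s t + d t (q (Suc l))"
    using s t near_s near_t by (auto intro!: triangle)
  then have dY: "d (p (Suc l)) (q (Suc l)) \<le> Y (Suc l)"
    using near_s(3) near_t(3) commute[of s "p (Suc l)"] unfolding Y_def by linarith
  have e_nonneg: "0 \<le> rdrift n s k" "0 \<le> rdrift n t k" for k
    using rdrift_nonneg s t by blast+
  show ?case
  \<comment> \<open>The ball around \<open>q (Suc l)\<close> stays within \<open>Y (Suc l)\<close>
    plus twice the drift of \<open>t\<close> from \<open>p (Suc l)\<close>, and
    \<open>radius l\<close> drops by at most the drift of \<open>s\<close> between \<open>s\<close>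
    and \<open>p (Suc l)\<close>. Together this is at most \<open>3 * Y (Suc l)\<close>.\<close>
  proof (cases "radius l s > 3 * Y (Suc l)")
    case True
    have "radius (Suc l) t \<le> rdrift n t (Suc l)"
    proof (cases "Suc l < n")
      case True
      then show ?thesis using radius_nonneg[OF t, of "Suc l"] e_nonneg(2)[of "Suc (Suc l)"]
        by (subst drift_step) auto
    next
      case False
      then have "n = Suc l" using Suc.prems by simp
      then show ?thesis using radius_nonneg[OF t, of "Suc l"] by simp
    qed
    moreover have "radius (Suc l) (q (Suc l)) \<le> radius (Suc l) t + d t (q (Suc l))"
      using t near_t by (intro radius_lipschitz)
    moreover have "radius l s \<le> radius l (p (Suc l)) + d (p (Suc l)) s"
      using s near_s by (intro radius_lipschitz)
    ultimately have "d (q (Suc l)) (p (Suc l)) + radius (Suc l) (q (Suc l)) < radius l (p (Suc l))"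
      using True dY near_s(3) near_t(3) e_nonneg[of "Suc l"] nonneg[of s t]
        commute[of s "p (Suc l)"] commute[of "q (Suc l)" "p (Suc l)"]
      unfolding Y_def by argo
    then have "(p (Suc l), q (Suc l)) \<in> links l"
      using near_s near_t mcball_subset_mball by (auto simp: links_def close_pairs_def)
    then have "\<bar>f (p (Suc l)) - f (q (Suc l))\<bar> \<le> \<Lambda> * (R ^ l * Y (Suc l))"
      using dY by (rule f_link)
    also have "\<dots> \<le> \<Lambda> * (R ^ Suc l * Y (Suc l))"
      using \<Lambda> R_ge e_nonneg by (intro mult_left_mono mult_right_mono) (auto simp: Y_def)
    finally show ?thesis by (simp add: Y_def)
  next
    case False
    have "radius l t \<le> radius l s + d s t" using s t by (intro radius_lipschitz)
    \<comment> \<open>Writing Y for \<open>Y (Suc l)\<close>, the radii at \<open>s\<close> and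
      \<open>t\<close> are at most 3 Y and 3 Y + \<open>d s t\<close>. Tripled, they contribute 18 Y
      + 3 \<open>d s t\<close>; the remaining distance and four times the drifts complete this to at
      most 22 Y.\<close>
    then have Y: "Y l \<le> 22 * Y (Suc l)"
      using False e_nonneg[of "Suc l"] nonneg[of s t]
      unfolding Y_def drift_step[OF ln] by argo
    have "\<bar>f (p (Suc l)) - f (p l)\<bar> \<le> \<Lambda> * (R ^ l * rdrift n s l)"
      using chain_step[OF s p ln] by (rule f_link)
    moreover have "\<bar>f (q (Suc l)) - f (q l)\<bar> \<le> \<Lambda> * (R ^ l * rdrift n t l)"
      using chain_step[OF t q ln] by (rule f_link)
    moreover have "\<bar>f (p l) - f (q l)\<bar> \<le> \<Lambda> * (R ^ l * Y l)"
      using Suc unfolding Y_def by simp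
    ultimately have "\<bar>f (p (Suc l)) - f (q (Suc l))\<bar>
        \<le> \<Lambda> * (R ^ l * rdrift n s l) + \<Lambda> * (R ^ l * rdrift n t l) + \<Lambda> * (R ^ l * Y l)" by linarith
    also have "\<dots> = \<Lambda> * (R ^ l * (rdrift n s l + rdrift n t l + Y l))" by (simp add: algebra_simps)
    also have "\<dots> \<le> \<Lambda> * (R ^ l * (R * Y (Suc l)))"
    proof (intro mult_left_mono)
      have "rdrift n s l + rdrift n t l \<le> Y l" by (simp add: Y_def)
      then have "rdrift n s l + rdrift n t l + Y l \<le> 44 * Y (Suc l)" using Y by linarith
      also have "\<dots> \<le> R * Y (Suc l)"
        using R_ge e_nonneg by (intro mult_right_mono) (auto simp: Y_def)
      finally show "rdrift n s l + rdrift n t l + Y l \<le> R * Y (Suc l)" .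
    qed (use \<Lambda> R_ge in auto)
    finally show ?thesis by (simp add: Y_def mult_ac)
  qed
qed

text \<open>Two descents from level \<open>n\<close> to level \<open>l\<close>, followed by the
  meeting at level \<open>l\<close>. The drifts in the latter are the boundary terms for which
  \<open>drift_sum_le\<close> leaves room.\<close>

lemma chain_bound:
  assumes s: "s \<in> T" and t: "t \<in> T" and l: "l \<le> n"
  shows "\<bar>f (proj n s) - f (proj n t)\<bar> \<le> \<Lambda> * (R ^ l * d s t
    + 6 * (\<Sum>i=l..n. R ^ i * radius i s) + 6 * (\<Sum>i=l..n. R ^ i * radius i t))"
proof -
  obtain p q where p: "chain n s p" and q: "chain n t q" using chain_exists by blast
  have sum: "(\<Sum>j=l..<n. R ^ j * rdrift n x j) + R ^ l * rdrift n x l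
      \<le> 6 * (\<Sum>i=l..n. R ^ i * radius i x)" if "x \<in> T" for x
    using that R_ge by (intro drift_sum_le radius_nonneg l) auto
  have "p n = proj n s" "q n = proj n t" using p q by (auto simp: chain_def)
  then have "\<bar>f (proj n s) - f (proj n t)\<bar>
      \<le> \<Lambda> * (\<Sum>j=l..<n. R ^ j * rdrift n s j) + \<Lambda> * (\<Sum>j=l..<n. R ^ j * rdrift n t j)
        + \<Lambda> * (R ^ l * (d s t + rdrift n s l + rdrift n t l))"
    using chain_increment[OF s p l] chain_increment[OF t q l] chains_meet[OF s p t q l] by simp
  also have "\<dots> = \<Lambda> * (R ^ l * d s t
      + ((\<Sum>j=l..<n. R ^ j * rdrift n s j) + R ^ l * rdrift n s l)
      + ((\<Sum>j=l..<n. R ^ j * rdrift n t j) + R ^ l * rdrift n t l))"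
    by (simp add: algebra_simps)
  also have "\<dots> \<le> \<Lambda> * (R ^ l * d s t
      + 6 * (\<Sum>i=l..n. R ^ i * radius i s) + 6 * (\<Sum>i=l..n. R ^ i * radius i t))"
    by (intro mult_left_mono add_mono order.refl sum s t \<Lambda>)
  finally show ?thesis .
qed

end

end

subsection \<open>Minorizing integrals\<close>

lemma sum_powers_le_twice_top:
  fixes R :: real
  assumes "2 \<le> R"
  shows "(\<Sum>i\<le>k. R ^ i) \<le> 2 * R ^ k"
proof (induction k)
  case (Suc k)
  have "2 * R ^ k \<le> R ^ Suc k" using assms by simp
  then show ?case using Suc by simp
qed simp

lemma ennreal_inverse_antimono: "a \<le> b \<Longrightarrow> inverse b \<le> (inverse a :: ennreal)"
  including ennreal.lifting by transfer (simp add: ereal_inverse_antimono)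

context compact_metric_measure
begin

context
  fixes \<phi> :: "real \<Rightarrow> real"
  assumes \<phi>: "young_function \<phi>" "\<phi> 1 = 1"
begin

abbreviation inv_mass :: "'a \<Rightarrow> real \<Rightarrow> ennreal" where
  "inv_mass x \<epsilon> \<equiv> young_inv \<phi> (1 / emeasure m (mcball x \<epsilon>))"

lemma one_le_inverse_mass: "1 \<le> 1 / emeasure m A"
proof -
  have "inverse 1 \<le> inverse (emeasure m A)"
    by (intro ennreal_inverse_antimono emeasure_le_1)
  then show ?thesis by (simp add: divide_ennreal_def)
qed

lemma inv_mass_antimono:
  assumes "d x y + \<delta> \<le> \<epsilon>" "y \<in> T"
  shows "inv_mass y \<epsilon> \<le> inv_mass x \<delta>"
proof (rule young_inv_mono[OF \<phi> one_le_inverse_mass])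
  show "1 / emeasure m (mcball y \<epsilon>) \<le> 1 / emeasure m (mcball x \<delta>)"
    unfolding divide_ennreal_def
    by (intro mult_left_mono ennreal_inverse_antimono emeasure_mono mcball_subset assms) auto
qed

lemma inv_mass_antimono_radius: "x \<in> T \<Longrightarrow> \<delta> \<le> \<epsilon> \<Longrightarrow> inv_mass x \<epsilon> \<le> inv_mass x \<delta>"
  by (rule inv_mass_antimono) auto

lemma inv_mass_ge:
  assumes c: "1 \<le> c" and "measure m (mcball x \<epsilon>) \<le> 1 / \<phi> c"
  shows "ennreal c \<le> inv_mass x \<epsilon>"
proof (rule young_inv_ge[OF \<phi> c])
  have pos: "0 < \<phi> c" using young_ge_self[OF \<phi> c] c by linarith
  have "emeasure m (mcball x \<epsilon>) \<le> ennreal (1 / \<phi> c)"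
    using assms unfolding emeasure_eq_measure by (intro ennreal_leI)
  then have "inverse (ennreal (1 / \<phi> c)) \<le> inverse (emeasure m (mcball x \<epsilon>))"
    by (rule ennreal_inverse_antimono)
  then show "ennreal (\<phi> c) \<le> 1 / emeasure m (mcball x \<epsilon>)"
    using pos by (simp add: divide_ennreal_def inverse_ennreal)
qed

lemma inv_mass_ge_1: "1 \<le> inv_mass x \<epsilon>"
  using inv_mass_ge[of 1 x \<epsilon>] \<phi> by simp

lemma inv_mass_finite: "measure m (mcball x \<epsilon>) > 0 \<Longrightarrow> inv_mass x \<epsilon> < \<infinity>"
  by (auto simp: young_inv_def ennreal_divide_eq_top_iff emeasure_eq_measure)

lemma minorizing_integral_ge:
  assumes "0 \<le> \<delta>" "\<And>\<epsilon>. 0 \<le> \<epsilon> \<Longrightarrow> \<epsilon> \<le> \<delta> \<Longrightarrow> c \<le> inv_mass x \<epsilon>"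
  shows "c * ennreal \<delta> \<le> minorizing_integral T d m \<phi> x \<delta>"
proof -
  have "c * ennreal \<delta> = (\<integral>\<^sup>+\<epsilon>\<in>{0..\<delta>}. c \<partial>lborel)"
    using assms by (simp add: nn_integral_cmult_indicator)
  also have "\<dots> \<le> minorizing_integral T d m \<phi> x \<delta>"
    unfolding minorizing_integral_def
    by (intro nn_integral_mono) (use assms in \<open>auto simp: indicator_def\<close>)
  finally show ?thesis .
qed

text \<open>Masses are at most one and \<open>\<phi> 1 = 1\<close>, so the integrand is at least
  one.\<close>

lemma le_minorizing_integral: "0 \<le> \<delta> \<Longrightarrow> ennreal \<delta> \<le> minorizing_integral T d m \<phi> x \<delta>"
  using minorizing_integral_ge[of \<delta> 1 x] inv_mass_ge_1 by simp

lemma minorizing_integral_mono: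
  "\<delta> \<le> \<delta>' \<Longrightarrow> minorizing_integral T d m \<phi> x \<delta> \<le> minorizing_integral T d m \<phi> x \<delta>'"
  unfolding minorizing_integral_def by (intro nn_integral_mono) (auto simp: indicator_def)

text \<open>Around a null ball the integrand would be infinite on an interval of positive
  length.\<close>

lemma positive_mass_if_integral_finite:
  assumes "minorizing_integral T d m \<phi> x \<delta> < \<infinity>" "0 < \<delta>" "0 < \<epsilon>"
  shows "0 < measure m (mcball x \<epsilon>)"
proof (rule ccontr)
  assume "\<not> ?thesis"
  then have 0: "measure m (mcball x \<epsilon>) = 0" using zero_less_measure_iff by blast
  have "\<infinity> * ennreal (min \<delta> \<epsilon>) \<le> minorizing_integral T d m \<phi> x (min \<delta> \<epsilon>)"
  proof (rule minorizing_integral_ge)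
    fix \<eta> assume "\<eta> \<le> min \<delta> \<epsilon>"
    then have "measure m (mcball x \<eta>) \<le> measure m (mcball x \<epsilon>)"
      by (intro finite_measure_mono mcball_subset_concentric) auto
    then have "measure m (mcball x \<eta>) = 0" using 0 measure_nonneg[of m "mcball x \<eta>"] by linarith
    then have "1 / emeasure m (mcball x \<eta>) = \<infinity>"
      by (simp add: emeasure_eq_measure divide_ennreal_def)
    then show "\<infinity> \<le> inv_mass x \<eta>" by (simp add: young_inv_def)
  qed (use assms in auto)
  also have "\<dots> \<le> minorizing_integral T d m \<phi> x \<delta>" by (intro minorizing_integral_mono) auto
  finally show False using assms by (simp add: ennreal_top_mult min_def split: if_splits)
qed

text \<open>Monotonicity in the radius turns superlevel sets into intervals.\<close>

lemma inv_mass_measurable: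
  assumes x: "x \<in> T"
  shows "inv_mass x \<in> borel_measurable borel"
proof (rule borel_measurableI_greater)
  fix c :: ennreal
  have "is_interval {\<epsilon>. c < inv_mass x \<epsilon>}"
    unfolding is_interval_1
    using inv_mass_antimono_radius[OF x] by (blast intro: less_le_trans)
  then show "{\<epsilon>\<in>space borel. c < inv_mass x \<epsilon>} \<in> sets borel"
    using real_interval_borel_measurable by simp
qed

text \<open>Beyond \<open>h = d x y\<close> a ball around \<open>y\<close> contains the ball around
  \<open>x\<close> whose radius is smaller by \<open>h\<close>; translating Lebesgue measure turns
  this part into the integral at \<open>x\<close>.\<close>

lemma minorizing_integral_shift:
  assumes x: "x \<in> T" and y: "y \<in> T" and "0 \<le> \<delta>"
  shows "minorizing_integral T d m \<phi> y \<delta>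
    \<le> minorizing_integral T d m \<phi> y (d x y) + minorizing_integral T d m \<phi> x \<delta>"
proof -
  define h where "h = d x y"
  have [measurable]: "inv_mass x \<in> borel_measurable lborel" "inv_mass y \<in> borel_measurable lborel"
    using inv_mass_measurable[OF x] inv_mass_measurable[OF y] by auto
  have "minorizing_integral T d m \<phi> y \<delta>
      \<le> (\<integral>\<^sup>+\<epsilon>. inv_mass y \<epsilon> * indicator {0..h} \<epsilon> + inv_mass x (\<epsilon> - h) * indicator {0..\<delta>} (\<epsilon> - h) \<partial>lborel)"
    unfolding minorizing_integral_def
  proof (intro nn_integral_mono)
    fix \<epsilon> :: real
    have "inv_mass y \<epsilon> \<le> inv_mass x (\<epsilon> - h)" by (intro inv_mass_antimono y) (simp add: h_def)
    moreover have "0 \<le> h" by (simp add: h_def)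
    ultimately show "inv_mass y \<epsilon> * indicator {0..\<delta>} \<epsilon>
        \<le> inv_mass y \<epsilon> * indicator {0..h} \<epsilon> + inv_mass x (\<epsilon> - h) * indicator {0..\<delta>} (\<epsilon> - h)"
      by (auto simp: indicator_def)
  qed
  also have "\<dots> = (\<integral>\<^sup>+\<epsilon>. inv_mass y \<epsilon> * indicator {0..h} \<epsilon> \<partial>lborel)
      + (\<integral>\<^sup>+\<epsilon>. inv_mass x (\<epsilon> - h) * indicator {0..\<delta>} (\<epsilon> - h) \<partial>lborel)"
    by (intro nn_integral_add) measurable
  also have "(\<integral>\<^sup>+\<epsilon>. inv_mass x (\<epsilon> - h) * indicator {0..\<delta>} (\<epsilon> - h) \<partial>lborel)
      = minorizing_integral T d m \<phi> x \<delta>"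
    using nn_integral_real_affine[of "\<lambda>\<epsilon>. inv_mass x \<epsilon> * indicator {0..\<delta>} \<epsilon>" 1 "- h"]
    by (simp add: minorizing_integral_def)
  finally show ?thesis unfolding h_def minorizing_integral_def .
qed

text \<open>Past \<open>\<delta>\<close> the integrand, antitone in the radius, stays below its
  value at \<open>\<delta>\<close>.\<close>

lemma minorizing_integral_extend:
  assumes x: "x \<in> T" and "0 \<le> \<delta>" "0 \<le> h"
  shows "minorizing_integral T d m \<phi> x (\<delta> + h)
    \<le> minorizing_integral T d m \<phi> x \<delta> + inv_mass x \<delta> * ennreal h"
proof -
  have [measurable]: "inv_mass x \<in> borel_measurable lborel"
    using inv_mass_measurable[OF x] by simp
  have "minorizing_integral T d m \<phi> x (\<delta> + h)
      \<le> (\<integral>\<^sup>+\<epsilon>. inv_mass x \<epsilon> * indicator {0..\<delta>} \<epsilon> + inv_mass x \<delta> * indicator {\<delta>..\<delta> + h} \<epsilon> \<partial>lborel)"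
    unfolding minorizing_integral_def
    by (intro nn_integral_mono) (use inv_mass_antimono_radius[OF x, of \<delta>] in \<open>auto simp: indicator_def\<close>)
  also have "\<dots> = (\<integral>\<^sup>+\<epsilon>. inv_mass x \<epsilon> * indicator {0..\<delta>} \<epsilon> \<partial>lborel)
      + (\<integral>\<^sup>+\<epsilon>. inv_mass x \<delta> * indicator {\<delta>..\<delta> + h} \<epsilon> \<partial>lborel)"
    by (intro nn_integral_add) measurable
  also have "(\<integral>\<^sup>+\<epsilon>. inv_mass x \<delta> * indicator {\<delta>..\<delta> + h} \<epsilon> \<partial>lborel) = inv_mass x \<delta> * ennreal h"
    using assms by (subst nn_integral_cmult_indicator) auto
  finally show ?thesis unfolding minorizing_integral_def .
qed

lemma minorizing_metric_refl: "minorizing_metric T d m \<phi> x x = 0" if "x \<in> T"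
proof -
  have "minorizing_integral T d m \<phi> x 0 = 0"
  proof -
    have "AE \<epsilon> in lborel. \<epsilon> \<noteq> (0::real)" by (rule AE_lborel_singleton)
    then show ?thesis unfolding minorizing_integral_def
      using inv_mass_measurable[OF that] by (subst nn_integral_0_iff_AE) auto
  qed
  then show ?thesis using that by (simp add: minorizing_metric_def)
qed

end

end

locale young_chaining = metric_chaining T d m "\<lambda>k. \<phi> (R ^ k)" R
  for T :: "'a set" and d and m :: "'a measure" and \<phi> :: "real \<Rightarrow> real" and R :: real +
  assumes young: "young_function \<phi>" "\<phi> 1 = 1"
begin

abbreviation \<tau> :: "'a \<Rightarrow> 'a \<Rightarrow> ennreal" where
  "\<tau> \<equiv> minorizing_metric T d m \<phi>"

text \<open>Below \<open>radius i x\<close> balls have mass less than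
  \<open>1 / \<phi> (R ^ i)\<close>; this is how the integrand sees the radii.\<close>

lemma power_le_inv_mass:
  assumes "\<epsilon> < radius i x"
  shows "ennreal (R ^ i) \<le> young_inv \<phi> (1 / emeasure m (mcball x \<epsilon>))"
  using measure_mcball_less[OF a_inverse(1) assms] R_ge
  by (intro inv_mass_ge[OF young]) (auto intro: one_le_power less_imp_le)

text \<open>Each term is the integral of a step function of height \<open>R ^ i / 2\<close>. At
  \<epsilon>, with \<open>k\<close> the largest index whose radius exceeds \<epsilon>, the geometric
  sum of the heights is at most \<open>R ^ k\<close>, hence below the integrand;
  \<open>small\<close> keeps the steps inside \<open>{0..\<delta>}\<close>.\<close>

lemma sum_radius_le:
  assumes x: "x \<in> T" and small: "\<And>i. l \<le> i \<Longrightarrow> radius i x \<le> \<delta>"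
  shows "ennreal (\<Sum>i=l..n. R ^ i * radius i x / 2) \<le> minorizing_integral T d m \<phi> x \<delta>"
proof -
  have "ennreal (\<Sum>i=l..n. R ^ i * radius i x / 2) = (\<Sum>i=l..n. ennreal (R ^ i / 2 * radius i x))"
    using R_ge radius_nonneg[OF x] by (subst sum_ennreal) auto
  also have "\<dots> = (\<Sum>i=l..n. \<integral>\<^sup>+\<epsilon>. ennreal (R ^ i / 2) * indicator {0..<radius i x} \<epsilon> \<partial>lborel)"
    using R_ge radius_nonneg[OF x] by (intro sum.cong) (auto simp: nn_integral_cmult_indicator simp flip: ennreal_mult)
  also have "\<dots> = (\<integral>\<^sup>+\<epsilon>. (\<Sum>i=l..n. ennreal (R ^ i / 2) * indicator {0..<radius i x} \<epsilon>) \<partial>lborel)"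
    by (intro nn_integral_sum[symmetric]) measurable
  also have "\<dots> \<le> minorizing_integral T d m \<phi> x \<delta>"
    unfolding minorizing_integral_def
  proof (intro nn_integral_mono)
    fix \<epsilon> :: real
    define I where "I = {i\<in>{l..n}. 0 \<le> \<epsilon> \<and> \<epsilon> < radius i x}"
    have "(\<Sum>i=l..n. ennreal (R ^ i / 2) * indicator {0..<radius i x} \<epsilon>) = (\<Sum>i\<in>I. ennreal (R ^ i / 2))"
      unfolding I_def by (intro sum.mono_neutral_cong_right) (auto simp: indicator_def)
    also have "\<dots> \<le> young_inv \<phi> (1 / emeasure m (mcball x \<epsilon>)) * indicator {0..\<delta>} \<epsilon>"
    proof (cases "I = {}")
      case False
      define k where "k = Max I"
      have "finite I" by (simp add: I_def)
      then have k: "k \<in> I" and I: "I \<subseteq> {..k}" using False by (auto simp: k_def)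
      have "(\<Sum>i\<in>I. R ^ i) \<le> (\<Sum>i\<le>k. R ^ i)" using I R_ge by (intro sum_mono2) auto
      also have "\<dots> \<le> 2 * R ^ k" using R_ge by (intro sum_powers_le_twice_top) simp
      finally have "(\<Sum>i\<in>I. R ^ i / 2) \<le> R ^ k" by (simp flip: sum_divide_distrib)
      then have "(\<Sum>i\<in>I. ennreal (R ^ i / 2)) \<le> ennreal (R ^ k)"
        using R_ge by (subst sum_ennreal) (auto intro: ennreal_leI)
      also have "\<dots> \<le> young_inv \<phi> (1 / emeasure m (mcball x \<epsilon>))"
        using k by (intro power_le_inv_mass) (auto simp: I_def)
      also have "\<dots> = young_inv \<phi> (1 / emeasure m (mcball x \<epsilon>)) * indicator {0..\<delta>} \<epsilon>"
        using k small[of k] by (auto simp: I_def indicator_def)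
      finally show ?thesis .
    qed simp
    finally show "(\<Sum>i=l..n. ennreal (R ^ i / 2) * indicator {0..<radius i x} \<epsilon>)
        \<le> young_inv \<phi> (1 / emeasure m (mcball x \<epsilon>)) * indicator {0..\<delta>} \<epsilon>" .
  qed
  finally show ?thesis .
qed

text \<open>The ball of radius \<open>\<epsilon>\<close> has positive mass, which eventually exceeds
  \<open>1 / \<phi> (R ^ i)\<close> because \<open>\<phi> (R ^ i) \<ge> R ^ i\<close>.\<close>

lemma radius_eventually_le:
  assumes "minorizing_integral T d m \<phi> x \<delta> < \<infinity>" "0 < \<delta>" "0 < \<epsilon>"
  shows "\<exists>l. \<forall>i\<ge>l. radius i x \<le> \<epsilon>"
proof -
  define \<mu> where "\<mu> = measure m (mcball x \<epsilon>)"
  have \<mu>: "0 < \<mu>" unfolding \<mu>_def by (rule positive_mass_if_integral_finite[OF young assms])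
  obtain l where l: "1 / \<mu> < R ^ l" using real_arch_pow[of R "1 / \<mu>"] R_ge by auto
  have "radius i x \<le> \<epsilon>" if "l \<le> i" for i
  proof (rule rad_le)
    have "1 / \<mu> \<le> R ^ i" using l power_increasing[OF that, of R] R_ge by linarith
    also have "\<dots> \<le> \<phi> (R ^ i)" using R_ge by (intro young_ge_self[OF young]) (auto intro: one_le_power)
    finally show "1 / \<phi> (R ^ i) \<le> measure m (mcball x \<epsilon>)"
      using \<mu> a_pos[of i] by (simp add: \<mu>_def field_simps)
  qed (use assms in simp)
  then show ?thesis by blast
qed

text \<open>As \<open>R ^ i \<ge> 1\<close>, the bound of \<open>sum_radius_le\<close> covers the
  plain sums. Summability later yields almost sure convergence of a process along the
  projections.\<close>

lemma summable_radius:
  assumes x: "x \<in> T" and fin: "minorizing_integral T d m \<phi> x \<delta> < \<infinity>" and \<delta>: "0 < \<delta>"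
  shows "summable (\<lambda>i. radius i x)"
proof -
  obtain l where l: "\<And>i. l \<le> i \<Longrightarrow> radius i x \<le> \<delta>"
    using radius_eventually_le[OF fin \<delta> \<delta>] by blast
  obtain b where b: "minorizing_integral T d m \<phi> x \<delta> = ennreal b" "0 \<le> b"
    using fin by (cases "minorizing_integral T d m \<phi> x \<delta>") auto
  have "summable (\<lambda>i. radius (i + l) x)"
  proof (rule bounded_imp_summable)
    fix n
    have "(\<Sum>i\<le>n. radius (i + l) x) = (\<Sum>i=l..n+l. radius i x)"
      by (rule sum.reindex_bij_witness[of _ "\<lambda>i. i - l" "\<lambda>i. i + l"]) auto
    also have "\<dots> \<le> (\<Sum>i=l..n+l. R ^ i * radius i x)"
      using R_ge radius_nonneg[OF x] mult_right_mono[OF one_le_power[of R]]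
      by (intro sum_mono) force
    also have "\<dots> = 2 * (\<Sum>i=l..n+l. R ^ i * radius i x / 2)" by (simp flip: sum_divide_distrib)
    also have "\<dots> \<le> 2 * b"
      using sum_radius_le[OF x, of l \<delta> "n + l"] l b by simp
    finally show "(\<Sum>i\<le>n. radius (i + l) x) \<le> 2 * b" .
  qed (rule radius_nonneg[OF x])
  then show ?thesis using summable_iff_shift[of "\<lambda>i. radius i x" l] by simp
qed

lemma minorizing_metric_finite:
  assumes "\<tau> s t < \<infinity>"
  shows "minorizing_integral T d m \<phi> s (d s t) < \<infinity>" "minorizing_integral T d m \<phi> t (d s t) < \<infinity>"
  using assms by (auto simp: minorizing_metric_def)

text \<open>The descent stops at the least level \<open>l\<close> from which on all radii at
  \<open>s\<close> and \<open>t\<close> are at most \<open>d s t\<close>. The radius sums then fit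
  into the integrals up to \<open>d s t\<close>, and minimality of \<open>l\<close> controls the
  term \<open>R ^ l * d s t\<close>.\<close>

theorem chaining_inequality:
  assumes s: "s \<in> T" and t: "t \<in> T" and \<tau>: "\<tau> s t = ennreal b" "0 \<le> b" and \<Lambda>: "0 \<le> \<Lambda>"
    and f: "\<And>k u v. (u, v) \<in> links k \<Longrightarrow> \<bar>f u - f v\<bar> \<le> \<Lambda> * R ^ k * d u v"
    and lim: "(\<lambda>n. f (proj n s)) \<longlonglongrightarrow> f s" "(\<lambda>n. f (proj n t)) \<longlonglongrightarrow> f t"
  shows "\<bar>f s - f t\<bar> \<le> 2 * R * \<Lambda> * b"
proof (cases "s = t")
  case True
  then show ?thesis using \<tau> \<Lambda> R_ge by simp
next
  case False
  then have dpos: "0 < d s t" using s t mdist_pos_less by blast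
  have fin: "minorizing_integral T d m \<phi> s (d s t) < \<infinity>" "minorizing_integral T d m \<phi> t (d s t) < \<infinity>"
    by (intro minorizing_metric_finite; simp add: \<tau>)+
  have le_b: "c \<le> b" if "ennreal c \<le> minorizing_integral T d m \<phi> s (d s t) \<or>
      ennreal c \<le> minorizing_integral T d m \<phi> t (d s t)" for c
  proof -
    have "ennreal c \<le> \<tau> s t" using that by (auto simp: minorizing_metric_def le_max_iff_disj)
    then show ?thesis using \<tau> by simp
  qed
  define P where "P l \<longleftrightarrow> (\<forall>i\<ge>l. radius i s \<le> d s t \<and> radius i t \<le> d s t)" for l
  have "\<exists>l. P l"
  proof -
    obtain l1 l2 where "\<forall>i\<ge>l1. radius i s \<le> d s t" "\<forall>i\<ge>l2. radius i t \<le> d s t"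
      using radius_eventually_le[OF fin(1) dpos dpos] radius_eventually_le[OF fin(2) dpos dpos] by blast
    then show ?thesis unfolding P_def by (intro exI[of _ "max l1 l2"]) auto
  qed
  define l where "l = (LEAST l. P l)"
  have l: "P l" unfolding l_def using \<open>\<exists>l. P l\<close> by (rule LeastI_ex)
  have sum: "(\<Sum>i=l..n. R ^ i * radius i s) \<le> 2 * b" "(\<Sum>i=l..n. R ^ i * radius i t) \<le> 2 * b" for n
    using le_b[of "\<Sum>i=l..n. R ^ i * radius i s / 2"] le_b[of "\<Sum>i=l..n. R ^ i * radius i t / 2"]
      sum_radius_le[OF s, of l "d s t" n] sum_radius_le[OF t, of l "d s t" n] l
    by (auto simp: P_def simp flip: sum_divide_distrib)
  \<comment> \<open>At level \<open>l - 1\<close> one radius exceeds \<open>d s t\<close>, so at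
    that point the integrand is at least \<open>R ^ (l - 1)\<close> on the whole interval; the
    missing power costs the factor \<open>R\<close>. For \<open>l = 0\<close> the integrand is at
    least one.\<close>
  have top: "R ^ l * d s t \<le> R * b"
  proof (cases l)
    case 0
    have "d s t \<le> b" using dpos by (intro le_b disjI1 le_minorizing_integral[OF young]) simp
    also have "\<dots> \<le> R * b" using R_ge mult_right_mono[of 1 R b] \<tau>(2) by simp
    finally show ?thesis using 0 by simp
  next
    case (Suc k)
    then have "\<not> P k" unfolding l_def using not_less_Least[of k P] by (simp add: l_def)
    then obtain i where "k \<le> i" "d s t < radius i s \<or> d s t < radius i t"
      unfolding P_def by force
    moreover from this have "i = k" using l Suc unfolding P_def by (metis le_antisym not_less not_less_eq_eq)
    ultimately have "d s t < radius k s \<or> d s t < radius k t" by simp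
    moreover have "ennreal (R ^ k * d s t) \<le> minorizing_integral T d m \<phi> x (d s t)"
      if "d s t < radius k x" for x
    proof -
      have "ennreal (R ^ k) * ennreal (d s t) \<le> minorizing_integral T d m \<phi> x (d s t)"
        using that dpos by (intro minorizing_integral_ge[OF young] power_le_inv_mass) auto
      then show ?thesis using R_ge dpos by (simp add: ennreal_mult)
    qed
    ultimately have "R ^ k * d s t \<le> b" by (intro le_b) blast
    then have "R * (R ^ k * d s t) \<le> R * b" using R_ge by (intro mult_left_mono) auto
    then show ?thesis using Suc by (simp add: mult_ac)
  qed
  have bound: "\<bar>f (proj n s) - f (proj n t)\<bar> \<le> 2 * R * \<Lambda> * b" if "l \<le> n" for n
  proof -
    have "\<bar>f (proj n s) - f (proj n t)\<bar> \<le> \<Lambda> * (R ^ l * d s t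
        + 6 * (\<Sum>i=l..n. R ^ i * radius i s) + 6 * (\<Sum>i=l..n. R ^ i * radius i t))"
      using \<Lambda> f s t that by (rule chain_bound)
    also have "\<dots> \<le> \<Lambda> * (R * b + 6 * (2 * b) + 6 * (2 * b))"
      using \<Lambda> top sum by (intro mult_left_mono add_mono) auto
    \<comment> \<open>The 24 collects six times \<open>2 * b\<close> for each of the two radius
      sums; it is at most \<open>R\<close>.\<close>
    also have "\<dots> = \<Lambda> * ((R + 24) * b)" by (simp add: algebra_simps)
    also have "\<dots> \<le> \<Lambda> * (2 * R * b)"
      using \<Lambda> R_ge \<tau>(2) by (intro mult_left_mono mult_right_mono) auto
    finally show ?thesis by (simp add: mult_ac)
  qed
  have "(\<lambda>n. \<bar>f (proj n s) - f (proj n t)\<bar>) \<longlonglongrightarrow> \<bar>f s - f t\<bar>"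
    by (intro tendsto_rabs tendsto_diff lim)
  then show ?thesis by (rule LIMSEQ_le_const2) (use bound in blast)
qed

end

subsection \<open>Continuous functions\<close>

text \<open>By \<open>card_links\<close> the numerators bound the number of links of level
  \<open>k\<close>, so mass \<open>1 / \<psi> (R ^ (k + N))\<close> on every link amounts to a total
  of at most one.\<close>

locale weighted_chaining = young_chaining T d m \<phi> R
  for T :: "'a set" and d and m :: "'a measure" and \<phi> :: "real \<Rightarrow> real" and R :: real +
  fixes \<psi> :: "real \<Rightarrow> real" and N :: nat
  assumes psi: "young_function \<psi>" "\<psi> 1 = 1"
    and weights_summable: "summable (\<lambda>k. 2 * \<phi> (R ^ Suc (Suc k)) / \<psi> (R ^ (k + N)))"
    and weights_sum_le_1: "(\<Sum>k. 2 * \<phi> (R ^ Suc (Suc k)) / \<psi> (R ^ (k + N))) \<le> 1"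
begin

abbreviation weight :: "nat \<Rightarrow> real" where
  "weight k \<equiv> 1 / \<psi> (R ^ (k + N))"

text \<open>\<open>2 * R\<close> comes from \<open>chaining_inequality\<close>, and
  \<open>R ^ N\<close> from measuring slopes against \<open>R ^ (k + N)\<close>, the scale of the
  weights.\<close>

definition chain_const :: real where "chain_const = 2 * R * R ^ N"

lemma chain_const_pos: "0 < chain_const"
  using R_ge by (simp add: chain_const_def)

lemma scale_ge_1: "1 \<le> R ^ k"
  using R_ge by (simp add: one_le_power)

lemma weight_pos: "0 < weight k"
  using young_ge_self[OF psi scale_ge_1[of "k + N"]] scale_ge_1[of "k + N"] by simp

lemma weight_total: "(\<Sum>k. \<Sum>p\<in>links k. ennreal (weight k)) \<le> 1"
proof -
  have "(\<Sum>p\<in>links k. ennreal (weight k)) \<le> ennreal (2 * \<phi> (R ^ Suc (Suc k)) / \<psi> (R ^ (k + N)))" for k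
  proof -
    have "(\<Sum>p\<in>links k. ennreal (weight k)) = ennreal (real (card (links k)) * weight k)"
      using weight_pos[of k] by (simp add: ennreal_of_nat_eq_real_of_nat flip: ennreal_mult)
    also have "\<dots> \<le> ennreal (2 * \<phi> (R ^ Suc (Suc k)) * weight k)"
      using card_links[of k] weight_pos[of k] by (intro ennreal_leI mult_right_mono) auto
    finally show ?thesis by simp
  qed
  then have "(\<Sum>k. \<Sum>p\<in>links k. ennreal (weight k))
      \<le> (\<Sum>k. ennreal (2 * \<phi> (R ^ Suc (Suc k)) / \<psi> (R ^ (k + N))))"
    by (intro suminf_le) auto
  also have "\<dots> = ennreal (\<Sum>k. 2 * \<phi> (R ^ Suc (Suc k)) / \<psi> (R ^ (k + N)))"
    using weight_pos[THEN less_imp_le] a_pos[THEN less_imp_le]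
    by (intro suminf_ennreal2 weights_summable) (auto simp del: power_Suc)
  also have "\<dots> \<le> 1" using weights_sum_le_1 by simp
  finally show ?thesis .
qed

definition slope_bound :: "('a \<Rightarrow> real) \<Rightarrow> real \<Rightarrow> bool" where
  "slope_bound f \<Lambda> \<longleftrightarrow> 0 \<le> \<Lambda> \<and> (\<forall>k. \<forall>p\<in>links k. diff_quotient d f p \<le> \<Lambda> * R ^ (k + N))"

text \<open>The chaining inequality for one pair, simultaneously for all slope bounds, so that
  continuous functions and almost all paths of a process can be treated alike. It is vacuous where
  \<tau> is infinite.\<close>

definition chained :: "('a \<Rightarrow> real) \<Rightarrow> 'a \<Rightarrow> 'a \<Rightarrow> bool" where
  "chained f s t \<longleftrightarrow> (\<forall>b \<Lambda>. 0 \<le> b \<longrightarrow> \<tau> s t = ennreal b \<longrightarrow> slope_bound f \<Lambda> \<longrightarrow>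
     \<bar>f s - f t\<bar> \<le> chain_const * \<Lambda> * b)"

lemma chained_if_convergent:
  assumes s: "s \<in> T" and t: "t \<in> T"
    and lim: "s \<noteq> t \<Longrightarrow> \<tau> s t < \<infinity> \<Longrightarrow> (\<lambda>n. f (proj n s)) \<longlonglongrightarrow> f s \<and> (\<lambda>n. f (proj n t)) \<longlonglongrightarrow> f t"
  shows "chained f s t"
  unfolding chained_def
proof (intro allI impI)
  fix b \<Lambda> assume b: "0 \<le> b" "\<tau> s t = ennreal b" and \<Lambda>: "slope_bound f \<Lambda>"
  show "\<bar>f s - f t\<bar> \<le> chain_const * \<Lambda> * b"
  proof (cases "s = t")
    case True
    then show ?thesis using b \<Lambda> chain_const_pos by (simp add: slope_bound_def)
  next
    case False
    have "\<bar>f s - f t\<bar> \<le> 2 * R * (\<Lambda> * R ^ N) * b"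
    proof (rule chaining_inequality[OF s t b(2,1)])
      fix k u v assume uv: "(u, v) \<in> links k"
      show "\<bar>f u - f v\<bar> \<le> \<Lambda> * R ^ N * R ^ k * d u v"
      \<comment> \<open>A point may be its own projection. On such a link the quotient is 0/0 = 0,
        but the increment vanishes as well.\<close>
      proof (cases "u = v")
        case False
        then have "0 < d u v" using uv links_subset mdist_pos_less by blast
        moreover have "diff_quotient d f (u, v) \<le> \<Lambda> * R ^ (k + N)"
          using \<Lambda> uv by (auto simp: slope_bound_def)
        ultimately show ?thesis by (simp add: diff_quotient_def field_simps power_add)
      qed (use uv links_subset \<Lambda> R_ge in \<open>auto simp: slope_bound_def\<close>)
    qed (use \<Lambda> R_ge lim False b in \<open>auto simp: slope_bound_def\<close>)
    then show ?thesis by (simp add: chain_const_def mult_ac)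
  qed
qed

lemma proj_tendsto:
  assumes x: "x \<in> T" and "minorizing_integral T d m \<phi> x \<delta> < \<infinity>" "0 < \<delta>"
  shows "limitin mtopology (\<lambda>n. proj n x) x sequentially"
  unfolding limit_metric_sequentially
proof (intro conjI allI impI x)
  fix \<epsilon> :: real assume "0 < \<epsilon>"
  then obtain l where l: "\<And>i. l \<le> i \<Longrightarrow> radius i x \<le> \<epsilon> / 4"
    using radius_eventually_le[OF assms(2,3), of "\<epsilon> / 4"] by auto
  have "d (proj i x) x < \<epsilon>" if "l \<le> i" for i
    using proj(2)[OF x, of i] l[OF that] commute[of x "proj i x"] \<open>0 < \<epsilon>\<close> by linarith
  then show "\<exists>l. \<forall>i\<ge>l. proj i x \<in> T \<and> d (proj i x) x < \<epsilon>" using x by auto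
qed

lemma chained_continuous:
  assumes f: "continuous_map mtopology euclideanreal f" and s: "s \<in> T" and t: "t \<in> T"
  shows "chained f s t"
proof (rule chained_if_convergent[OF s t])
  assume "s \<noteq> t" and fin: "\<tau> s t < \<infinity>"
  then have "0 < d s t" using s t mdist_pos_less by blast
  then have "limitin mtopology (\<lambda>n. proj n s) s sequentially" "limitin mtopology (\<lambda>n. proj n t) t sequentially"
    using proj_tendsto minorizing_metric_finite[OF fin] s t by blast+
  then show "(\<lambda>n. f (proj n s)) \<longlonglongrightarrow> f s \<and> (\<lambda>n. f (proj n t)) \<longlonglongrightarrow> f t"
    using continuous_map_limit[OF f] by (force simp: o_def)
qed

text \<open>Convexity moves the factor \<open>1 + w\<close> of \<open>plus_part_bound\<close> into
  the argument of \<psi>, so the slope is linear in \<open>w\<close>.\<close>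

lemma slope_bound_linear:
  assumes "0 \<le> w" and le: "\<And>k p. p \<in> links k \<Longrightarrow> weight k * plus_part \<psi> (diff_quotient d f p) \<le> w"
  shows "slope_bound f (1 + w)"
  unfolding slope_bound_def
proof (intro conjI allI ballI)
  fix k p assume p: "p \<in> links k"
  have "\<psi> (diff_quotient d f p) \<le> (1 + w) * \<psi> (R ^ (k + N))"
    using assms le[OF p] scale_ge_1 by (intro plus_part_bound psi) auto
  also have "\<dots> \<le> \<psi> ((1 + w) * R ^ (k + N))"
    using assms scale_ge_1[of "k + N"] by (intro young_scale_ge psi) auto
  finally show "diff_quotient d f p \<le> (1 + w) * R ^ (k + N)"
    using assms(1) mult_mono[of 1 "1 + w" 1 "R ^ (k + N)"] scale_ge_1[of "k + N"]
    by (auto intro!: young_le_cancel_ge_1[OF psi, of "(1 + w) * R ^ (k + N)"])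
qed (use assms in simp)

text \<open>With \<open>1 + w = \<psi> x\<close> the condition on \<open>r\<close> merges the two
  values of \<psi>, so the slope is of the order of the \<psi>-preimage of
  \<open>1 + w\<close>.\<close>

lemma slope_bound_nabla:
  assumes "0 \<le> w" and le: "\<And>k p. p \<in> links k \<Longrightarrow> weight k * plus_part \<psi> (diff_quotient d f p) \<le> w"
    and r: "1 < r" "\<And>x y. 1 \<le> x \<Longrightarrow> 1 \<le> y \<Longrightarrow> \<psi> x * \<psi> y \<le> \<psi> (r * x * y)"
    and x: "1 \<le> x" "\<psi> x = 1 + w"
  shows "slope_bound f (r * x)"
  unfolding slope_bound_def
proof (intro conjI allI ballI)
  fix k p assume p: "p \<in> links k"
  have "\<psi> (diff_quotient d f p) \<le> (1 + w) * \<psi> (R ^ (k + N))"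
    using assms le[OF p] scale_ge_1 by (intro plus_part_bound psi) auto
  also have "\<dots> \<le> \<psi> (r * x * R ^ (k + N))"
    using r(2)[OF x(1) scale_ge_1[of "k + N"]] x by simp
  finally show "diff_quotient d f p \<le> r * x * R ^ (k + N)"
    using r(1) x(1) mult_mono[of 1 "r * x" 1 "R ^ (k + N)"] mult_mono[of 1 r 1 x] scale_ge_1[of "k + N"]
    by (auto intro!: young_le_cancel_ge_1[OF psi, of "r * x * R ^ (k + N)"])
qed (use r x in simp)

text \<open>A discrete measure with a density against counting measure, viewed on the Borel sets of
  the product. The lower bound uses only the atom at \<open>p\<close>, so it holds for arbitrary
  \<open>g\<close>.\<close>

lemma chaining_measure_exists:
  obtains \<nu> where "borel_probability (prod_topology mtopology mtopology) \<nu>"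
    "\<And>k p g. p \<in> links k \<Longrightarrow> ennreal (weight k) * g p \<le> (\<integral>\<^sup>+ q. g q \<partial>\<nu>)"
proof -
  define PT where "PT = prod_topology mtopology mtopology"
  have topPT: "topspace PT = T \<times> T" by (simp add: PT_def)
  obtain z where z: "z \<in> T" using not_empty by auto
  define h where "h p = (\<Sum>k. \<Sum>q\<in>links k. ennreal (weight k) * indicator {q} p)" for p
  \<comment> \<open>The weights may sum to less than one; the missing mass goes to a diagonal
    point.\<close>
  define h' where "h' p = h p + (1 - integral\<^sup>N (count_space (T \<times> T)) h) * indicator {(z, z)} p" for p
  have int1: "(\<integral>\<^sup>+ p. c * indicator {q} p \<partial>count_space (T \<times> T)) = c" if "q \<in> T \<times> T" for q and c :: ennreal
    using that by (subst nn_integral_cmult_indicator) auto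
  have inth: "integral\<^sup>N (count_space (T \<times> T)) h \<le> 1"
  proof -
    have "integral\<^sup>N (count_space (T \<times> T)) h
        = (\<Sum>k. \<Sum>q\<in>links k. \<integral>\<^sup>+ p. ennreal (weight k) * indicator {q} p \<partial>count_space (T \<times> T))"
      unfolding h_def
      by (subst nn_integral_suminf, simp, intro suminf_cong nn_integral_sum) simp
    also have "\<dots> = (\<Sum>k. \<Sum>q\<in>links k. ennreal (weight k))"
      using links_subset by (intro suminf_cong sum.cong int1) auto
    finally show ?thesis using weight_total by simp
  qed
  define \<mu> where "\<mu> = density (count_space (T \<times> T)) h'"
  have tot: "integral\<^sup>N (count_space (T \<times> T)) h' = 1"
  proof -
    have "integral\<^sup>N (count_space (T \<times> T)) h'
        = integral\<^sup>N (count_space (T \<times> T)) h + (1 - integral\<^sup>N (count_space (T \<times> T)) h)"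
      unfolding h'_def using z by (subst nn_integral_add) (auto simp: int1)
    then show ?thesis using inth by (simp add: add_diff_inverse_ennreal)
  qed
  define B where "B = sigma (T \<times> T) {U. openin PT U}"
  have gen: "{U. openin PT U} \<subseteq> Pow (T \<times> T)" using openin_subset topPT by blast
  have B: "space B = T \<times> T" "sets B = sigma_sets (T \<times> T) {U. openin PT U}"
    unfolding B_def using gen by (simp_all add: space_measure_of sets_measure_of)
  \<comment> \<open>All subsets are measurable for \<open>\<mu>\<close>, so the identity pushes it
    forward to exactly the Borel sets that \<open>borel_probability\<close> prescribes.\<close>
  have meas: "(\<lambda>p. p) \<in> measurable \<mu> B"
    using sets.sets_into_space[of _ B] B(1) by (auto simp: \<mu>_def measurable_def)
  define \<nu> where "\<nu> = distr \<mu> B (\<lambda>p. p)"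
  have em: "emeasure \<nu> A = (\<integral>\<^sup>+ p. h' p * indicator A p \<partial>count_space (T \<times> T))" if "A \<in> sets B" for A
  proof -
    have "A \<subseteq> T \<times> T" using sets.sets_into_space[OF that] B by simp
    then show ?thesis unfolding \<nu>_def using that meas
      by (subst emeasure_distr) (auto simp: \<mu>_def emeasure_density Int_absorb2)
  qed
  have "emeasure \<nu> (T \<times> T) = 1"
  proof -
    have "T \<times> T \<in> sets B" using sets.top[of B] B by simp
    then have "emeasure \<nu> (T \<times> T) = (\<integral>\<^sup>+ p. h' p * indicator (T \<times> T) p \<partial>count_space (T \<times> T))" by (rule em)
    also have "\<dots> = integral\<^sup>N (count_space (T \<times> T)) h'" by (intro nn_integral_cong) auto
    finally show ?thesis using tot by simp
  qed
  then have "prob_space \<nu>" by (intro prob_spaceI) (simp add: \<nu>_def B)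
  then have 1: "borel_probability PT \<nu>"
    by (simp add: borel_probability_def \<nu>_def B topPT)
  have 2: "ennreal (weight k) * g p \<le> (\<integral>\<^sup>+ q. g q \<partial>\<nu>)" if p: "p \<in> links k" for k p g
  proof -
    have pT: "p \<in> T \<times> T" using p links_subset by blast
    have "Hausdorff_space PT"
      unfolding PT_def using Hausdorff_space_mtopology by (simp add: Hausdorff_space_prod_topology)
    then have "closedin PT {p}" using pT topPT by (simp add: closedin_Hausdorff_sing_eq)
    then have "T \<times> T - (T \<times> T - {p}) \<in> sigma_sets (T \<times> T) {U. openin PT U}"
      by (intro sigma_sets.Compl sigma_sets.Basic) (auto simp: closedin_def topPT)
    moreover have "T \<times> T - (T \<times> T - {p}) = {p}" using pT by auto
    ultimately have sing: "{p} \<in> sets B" using B by simp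
    have "ennreal (weight k) \<le> (\<Sum>q\<in>links k. ennreal (weight k) * indicator {q} p)"
      using p sum_nonneg_leq_bound[of "links k"]
      by (subst sum.remove[of _ p]) auto
    also have "\<dots> \<le> h p"
      unfolding h_def
      using sum_le_suminf[of "\<lambda>k. \<Sum>q\<in>links k. ennreal (weight k) * indicator {q} p" "{k}"] by simp
    also have "\<dots> \<le> h' p" by (simp add: h'_def)
    also have "h' p = emeasure \<nu> {p}"
    proof -
      have "emeasure \<nu> {p} = (\<integral>\<^sup>+ q. h' p * indicator {p} q \<partial>count_space (T \<times> T))"
        unfolding em[OF sing] by (intro nn_integral_cong) (auto simp: indicator_def)
      then show ?thesis using int1[OF pT] by simp
    qed
    finally have "ennreal (weight k) * g p \<le> g p * emeasure \<nu> {p}"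
      by (subst mult.commute) (rule mult_left_mono, auto)
    also have "\<dots> = (\<integral>\<^sup>+ q. g p * indicator {p} q \<partial>\<nu>)"
      using sing by (subst nn_integral_cmult_indicator) (auto simp: \<nu>_def)
    also have "\<dots> \<le> (\<integral>\<^sup>+ q. g q \<partial>\<nu>)"
      by (intro nn_integral_mono) (auto simp: indicator_def)
    finally show ?thesis .
  qed
  show ?thesis using that[OF 1[unfolded PT_def] 2] .
qed

text \<open>For every \<open>c\<close> admissible in the Luxemburg infimum the function
  \<open>f / c\<close> has integral at most one, hence slope bound \<open>1 + 1\<close>; this is the
  factor 2 required of \<open>K\<close>.\<close>

lemma luxemburg_inequality:
  assumes \<nu>: "\<And>k p g. p \<in> links k \<Longrightarrow> ennreal (weight k) * g p \<le> (\<integral>\<^sup>+ q. g q \<partial>\<nu>)"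
    and f: "continuous_map mtopology euclideanreal f"
    and K: "2 * chain_const \<le> K" and s: "s \<in> T" and t: "t \<in> T" and fin: "\<tau> s t \<noteq> \<infinity>"
  shows "ennreal \<bar>f s - f t\<bar> \<le> ennreal K * luxemburg (plus_part \<psi>) \<nu> (diff_quotient d f) * \<tau> s t"
proof (cases "s = t")
  case False
  then have dpos: "0 < d s t" using s t mdist_pos_less by blast
  obtain b where b: "\<tau> s t = ennreal b" "0 \<le> b" using fin by (cases "\<tau> s t") auto
  \<comment> \<open>This makes \<open>b\<close> positive, so that it can be divided by before the
    infimum is taken.\<close>
  have "ennreal (d s t) \<le> \<tau> s t"
    using le_minorizing_integral[OF young, of "d s t" s] dpos
    by (simp add: minorizing_metric_def le_max_iff_disj)
  then have bpos: "0 < b" using b dpos by simp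
  have Kpos: "0 < K" using K chain_const_pos by linarith
  have "ennreal (\<bar>f s - f t\<bar> / (K * b)) \<le> luxemburg (plus_part \<psi>) \<nu> (diff_quotient d f)"
    unfolding luxemburg_def
  proof (rule Inf_greatest, clarify)
    fix c :: real assume c: "0 < c"
      and int: "(\<integral>\<^sup>+ x. ennreal (plus_part \<psi> (\<bar>diff_quotient d f x\<bar> / c)) \<partial>\<nu>) \<le> 1"
    have dq: "diff_quotient d (\<lambda>x. f x / c) p = \<bar>diff_quotient d f p\<bar> / c" for p
      using c by (cases p) (simp add: diff_quotient_def abs_divide flip: diff_divide_distrib)
    have "slope_bound (\<lambda>x. f x / c) (1 + 1)"
    proof (rule slope_bound_linear)
      fix k p assume p: "p \<in> links k"
      have "ennreal (weight k) * ennreal (plus_part \<psi> (diff_quotient d (\<lambda>x. f x / c) p)) \<le> 1"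
        unfolding dq
        using \<nu>[OF p, of "\<lambda>x. ennreal (plus_part \<psi> (\<bar>diff_quotient d f x\<bar> / c))"] int by (rule order.trans)
      then show "weight k * plus_part \<psi> (diff_quotient d (\<lambda>x. f x / c) p) \<le> 1"
        using weight_pos[of k] by (simp flip: ennreal_mult)
    qed simp
    moreover have "chained (\<lambda>x. f x / c) s t"
      by (rule chained_continuous[OF _ s t])
        (use continuous_map_real_mult[OF f, of "\<lambda>_. 1 / c"] in simp)
    ultimately have "\<bar>f s / c - f t / c\<bar> \<le> chain_const * (1 + 1) * b" using b unfolding chained_def by blast
    then have "\<bar>f s - f t\<bar> \<le> (2 * chain_const) * b * c"
      using c by (simp add: abs_divide field_simps flip: diff_divide_distrib)
    also have "\<dots> \<le> K * b * c" using K b c by (intro mult_right_mono) auto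
    finally show "ennreal (\<bar>f s - f t\<bar> / (K * b)) \<le> ennreal c"
      using bpos Kpos by (intro ennreal_leI) (simp add: field_simps)
  qed
  then have "ennreal K * ennreal (\<bar>f s - f t\<bar> / (K * b)) * ennreal b
      \<le> ennreal K * luxemburg (plus_part \<psi>) \<nu> (diff_quotient d f) * \<tau> s t"
    unfolding b by (intro mult_left_mono mult_right_mono) auto
  moreover have "ennreal K * ennreal (\<bar>f s - f t\<bar> / (K * b)) * ennreal b = ennreal \<bar>f s - f t\<bar>"
    using bpos Kpos by (simp flip: ennreal_mult)
  ultimately show ?thesis by simp
qed simp

text \<open>With \<open>w\<close> the integral and \<open>\<psi> x = 1 + w\<close>, the slope bound
  \<open>r * x\<close> makes the scaled increments at most \<open>x\<close>, and
  \<open>plus_part \<psi> x\<close> returns exactly \<open>w\<close>.\<close>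

lemma nabla_inequality:
  assumes \<nu>: "\<And>k p g. p \<in> links k \<Longrightarrow> ennreal (weight k) * g p \<le> (\<integral>\<^sup>+ q. g q \<partial>\<nu>)"
    and f: "continuous_map mtopology euclideanreal f" and K: "chain_const \<le> K"
    and r: "1 < r" "\<And>x y. 1 \<le> x \<Longrightarrow> 1 \<le> y \<Longrightarrow> \<psi> x * \<psi> y \<le> \<psi> (r * x * y)"
  shows "(SUP s\<in>T. SUP t\<in>T. ext_top (plus_part \<psi>) (scaled_increment (K * r) \<tau> f s t))
    \<le> (\<integral>\<^sup>+ p. ennreal (plus_part \<psi> (diff_quotient d f p)) \<partial>\<nu>)"
proof (cases "\<integral>\<^sup>+ p. ennreal (plus_part \<psi> (diff_quotient d f p)) \<partial>\<nu>")
  case (real w)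
  have "weight k * plus_part \<psi> (diff_quotient d f p) \<le> w" if "p \<in> links k" for k p
    using \<nu>[OF that, of "\<lambda>x. ennreal (plus_part \<psi> (diff_quotient d f x))"] real weight_pos[of k]
    by (simp flip: ennreal_mult)
  moreover obtain x where x: "1 \<le> x" "\<psi> x = 1 + w"
    using young_preimage[OF psi, of "1 + w"] real by auto
  ultimately have slope: "slope_bound f (r * x)"
    using real r by (intro slope_bound_nabla[of w]) auto
  have "ext_top (plus_part \<psi>) (scaled_increment (K * r) \<tau> f s t) \<le> ennreal (plus_part \<psi> x)"
    if s: "s \<in> T" and t: "t \<in> T" for s t
  proof (rule ext_top_le)
    show "mono_on {0..} (plus_part \<psi>)"
      unfolding plus_part_def
      by (intro mono_onI max.mono diff_right_mono young_mono[OF psi(1)]) auto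
    show "scaled_increment (K * r) \<tau> f s t \<le> ennreal x"
    proof (rule scaled_increment_le)
      fix b assume b: "\<tau> s t = ennreal b" "0 \<le> b"
      have "\<bar>f s - f t\<bar> \<le> chain_const * (r * x) * b"
        using chained_continuous[OF f s t] b slope unfolding chained_def by blast
      also have "\<dots> \<le> K * (r * x) * b" using K r x b by (intro mult_right_mono) auto
      finally show "\<bar>f s - f t\<bar> \<le> K * r * x * b" by (simp add: mult_ac)
    qed (use K chain_const_pos r x in auto)
  qed (use x in auto)
  moreover have "plus_part \<psi> x = w" using x real by (simp add: plus_part_def)
  ultimately show ?thesis unfolding real by (intro SUP_least) auto
qed simp

end

subsection \<open>Processes\<close>

context weighted_chaining
begin

text \<open>The weighted integral of the difference quotient, written as a sum over the links so
  that it is measurable along a process.\<close>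

definition energy :: "('a \<Rightarrow> real) \<Rightarrow> ennreal" where
  "energy f = (\<Sum>k. \<Sum>p\<in>links k. ennreal (weight k * plus_part \<psi> (diff_quotient d f p)))"

lemma le_energy:
  assumes "p \<in> links k"
  shows "ennreal (weight k * plus_part \<psi> (diff_quotient d f p)) \<le> energy f"
proof -
  have "ennreal (weight k * plus_part \<psi> (diff_quotient d f p))
      \<le> (\<Sum>p\<in>links k. ennreal (weight k * plus_part \<psi> (diff_quotient d f p)))"
    using assms by (subst sum.remove[of _ p]) auto
  also have "\<dots> \<le> energy f"
    unfolding energy_def
    using sum_le_suminf[of "\<lambda>k. \<Sum>p\<in>links k. ennreal (weight k * plus_part \<psi> (diff_quotient d f p))" "{k}"]
    by simp
  finally show ?thesis .
qed

text \<open>Energy \<open>w\<close> gives the slope bound \<open>1 + w\<close>. The 2 in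
  \<open>2 * K\<close> halves it, which leaves mean at most one as soon as the energy has mean at
  most one.\<close>

lemma sup_increment_le:
  assumes chained: "\<And>s t. s \<in> S \<Longrightarrow> t \<in> S \<Longrightarrow> chained f s t" and K: "chain_const \<le> K"
  shows "(SUP s\<in>S. SUP t\<in>S. scaled_increment (2 * K) \<tau> f s t) \<le> (1 + energy f) / 2"
proof (cases "energy f")
  case (real w)
  have "slope_bound f (1 + w)"
    using le_energy[of _ _ f] real by (intro slope_bound_linear) auto
  then have "scaled_increment (2 * K) \<tau> f s t \<le> ennreal ((1 + w) / 2)" if "s \<in> S" "t \<in> S" for s t
  proof (intro scaled_increment_le)
    fix b assume b: "\<tau> s t = ennreal b" "0 \<le> b"
    have "\<bar>f s - f t\<bar> \<le> chain_const * (1 + w) * b"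
      using chained[OF that] b \<open>slope_bound f (1 + w)\<close> unfolding chained_def by blast
    also have "\<dots> \<le> K * (1 + w) * b" using K real b by (intro mult_right_mono) auto
    finally show "\<bar>f s - f t\<bar> \<le> 2 * K * ((1 + w) / 2) * b" by simp
  qed (use K chain_const_pos real in auto)
  moreover have "ennreal ((1 + w) / 2) = (1 + energy f) / 2"
    using real divide_ennreal[of "1 + w" 2] by simp
  ultimately show ?thesis by (intro SUP_least) auto
next
  case top
  then show ?thesis by (simp add: ennreal_top_divide)
qed

text \<open>Here the slope bound is \<open>r * x\<close> with \<open>\<psi> x = 1 + w\<close>. The
  \<open>r\<close> is absorbed by \<open>K\<close>, and the 2 in \<open>2 * K\<close> acts through
  convexity, \<open>\<psi> (x / 2) \<le> \<psi> x / 2\<close>.\<close>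

lemma sup_young_increment_le:
  assumes chained: "\<And>s t. s \<in> S \<Longrightarrow> t \<in> S \<Longrightarrow> chained f s t" and K: "chain_const * r \<le> K"
    and r: "1 < r" "\<And>x y. 1 \<le> x \<Longrightarrow> 1 \<le> y \<Longrightarrow> \<psi> x * \<psi> y \<le> \<psi> (r * x * y)"
  shows "(SUP s\<in>S. SUP t\<in>S. ext_top \<psi> (scaled_increment (2 * K) \<tau> f s t)) \<le> (1 + energy f) / 2"
proof (cases "energy f")
  case (real w)
  obtain x where x: "1 \<le> x" "\<psi> x = 1 + w"
    using young_preimage[OF psi, of "1 + w"] real by auto
  have slope: "slope_bound f (r * x)"
    using le_energy[of _ _ f] real r x by (intro slope_bound_nabla) auto
  have Kpos: "0 < K" using K chain_const_pos r mult_pos_pos[of chain_const r] by linarith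
  have "ext_top \<psi> (scaled_increment (2 * K) \<tau> f s t) \<le> ennreal (\<psi> (x / 2))"
    if st: "s \<in> S" "t \<in> S" for s t
  proof (rule ext_top_le)
    show "scaled_increment (2 * K) \<tau> f s t \<le> ennreal (x / 2)"
    proof (rule scaled_increment_le)
      fix b assume b: "\<tau> s t = ennreal b" "0 \<le> b"
      have "\<bar>f s - f t\<bar> \<le> chain_const * (r * x) * b"
        using chained[OF st] b slope unfolding chained_def by blast
      also have "\<dots> = chain_const * r * (x * b)" by simp
      also have "\<dots> \<le> K * (x * b)" using K x b by (intro mult_right_mono) auto
      finally show "\<bar>f s - f t\<bar> \<le> 2 * K * (x / 2) * b" by simp
    qed (use Kpos x in auto)
  qed (use x young_mono[OF psi(1)] in \<open>auto simp: mono_on_def\<close>)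
  moreover have "ennreal (\<psi> (x / 2)) \<le> (1 + energy f) / 2"
  proof -
    have "\<psi> (1 / 2 * x) \<le> 1 / 2 * \<psi> x" using x by (intro young_scale_le psi) auto
    then have "ennreal (\<psi> (x / 2)) \<le> ennreal ((1 + w) / 2)" using x by (intro ennreal_leI) simp
    then show ?thesis using real divide_ennreal[of "1 + w" 2] by simp
  qed
  ultimately show ?thesis by (intro SUP_least) (blast intro: order.trans)
next
  case top
  then show ?thesis by (simp add: ennreal_top_divide)
qed

text \<open>Points \<open>s'\<close>, \<open>t'\<close> of \<open>S\<close> close to
  \<open>s\<close>, \<open>t\<close> in \<open>d\<close>, \<tau> and \<open>f\<close> have
  \<tau>-distance at most that of \<open>s\<close>, \<open>t\<close> plus an error linear in the
  closeness \<open>\<eta>\<close>, so the inequality passes to the limit.\<close>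

lemma chained_approx:
  assumes s: "s \<in> T" and t: "t \<in> T"
    and approx: "\<And>x \<eta>. x \<in> {s, t} \<Longrightarrow> 0 < \<eta> \<Longrightarrow> minorizing_integral T d m \<phi> x 1 < \<infinity> \<Longrightarrow>
      \<exists>y\<in>S. y \<in> T \<and> d y x < \<eta> \<and> \<tau> y x < ennreal \<eta> \<and> \<bar>f y - f x\<bar> < \<eta>"
    and chained: "\<And>s t. s \<in> S \<Longrightarrow> t \<in> S \<Longrightarrow> chained f s t"
  shows "chained f s t"
  unfolding chained_def
proof (intro allI impI)
  fix b \<Lambda> assume b: "0 \<le> b" "\<tau> s t = ennreal b" and \<Lambda>: "slope_bound f \<Lambda>"
  then have "0 \<le> \<Lambda>" by (simp add: slope_bound_def)
  show "\<bar>f s - f t\<bar> \<le> chain_const * \<Lambda> * b"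
  proof (cases "s = t")
    case True
    then show ?thesis using b \<open>0 \<le> \<Lambda>\<close> chain_const_pos by simp
  next
    case False
    define \<delta> where "\<delta> = d s t"
    have \<delta>: "0 < \<delta>" using s t False mdist_pos_less by (simp add: \<delta>_def)
    have le_b: "minorizing_integral T d m \<phi> x \<delta> \<le> ennreal b" if "x \<in> {s, t}" for x
      using that unfolding b(2)[symmetric] minorizing_metric_def \<delta>_def by auto
    then have fin: "minorizing_integral T d m \<phi> x \<delta> < \<infinity>" if "x \<in> {s, t}" for x
      using that by (metis ennreal_less_top infinity_ennreal_def le_less_trans)
    obtain c where c: "0 \<le> c" "\<And>x. x \<in> {s, t} \<Longrightarrow> young_inv \<phi> (1 / emeasure m (mcball x \<delta>)) \<le> ennreal c"
    proof -
      define C where "C = max (young_inv \<phi> (1 / emeasure m (mcball s \<delta>))) (young_inv \<phi> (1 / emeasure m (mcball t \<delta>)))"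
      have "C < \<infinity>"
        unfolding C_def
        using inv_mass_finite[OF young positive_mass_if_integral_finite[OF young fin \<delta> \<delta>]]
        by simp
      then show ?thesis by (intro that[of "enn2real C"]) (auto simp: C_def)
    qed
    \<comment> \<open>The approximation hypothesis is guarded by the integral up to 1; finiteness up
      to \<open>\<delta>\<close> suffices because the integrand is at most \<open>c\<close>
      beyond.\<close>
    have fin1: "minorizing_integral T d m \<phi> x 1 < \<infinity>" if x: "x \<in> {s, t}" for x
    proof -
      have "minorizing_integral T d m \<phi> x 1 \<le> minorizing_integral T d m \<phi> x (\<delta> + max 0 (1 - \<delta>))"
        by (intro minorizing_integral_mono[OF young]) auto
      also have "\<dots> \<le> minorizing_integral T d m \<phi> x \<delta>
          + young_inv \<phi> (1 / emeasure m (mcball x \<delta>)) * ennreal (max 0 (1 - \<delta>))"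
        using x s t \<delta> by (intro minorizing_integral_extend[OF young]) auto
      also have "\<dots> \<le> ennreal b + ennreal c * ennreal (max 0 (1 - \<delta>))"
        using x le_b c by (intro add_mono mult_right_mono) auto
      also have "\<dots> < \<infinity>" by (simp add: ennreal_mult_less_top)
      finally show ?thesis .
    qed
    have bound: "\<bar>f s - f t\<bar> \<le> chain_const * \<Lambda> * b + (2 + chain_const * \<Lambda> * (1 + 2 * c)) * \<eta>" if \<eta>: "0 < \<eta>" for \<eta>
    proof -
      obtain s' where s': "s' \<in> S" "s' \<in> T" "d s' s < \<eta>" "\<tau> s' s < ennreal \<eta>" "\<bar>f s' - f s\<bar> < \<eta>"
        using approx[of s \<eta>] fin1 \<eta> by auto
      obtain t' where t': "t' \<in> S" "t' \<in> T" "d t' t < \<eta>" "\<tau> t' t < ennreal \<eta>" "\<bar>f t' - f t\<bar> < \<eta>"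
        using approx[of t \<eta>] fin1 \<eta> by auto
      \<comment> \<open>\<open>\<eta>\<close> pays for moving the centre,
        \<open>c * (2 * \<eta>)\<close> for lengthening the interval from \<open>\<delta>\<close> to
        \<open>\<delta> + 2 * \<eta>\<close>.\<close>
      define b' where "b' = b + \<eta> + c * (2 * \<eta>)"
      have "d s' t' \<le> d s' s + d s t'" "d s t' \<le> d s t + d t t'"
        using s t s' t' by (auto intro!: triangle)
      then have d': "d s' t' \<le> \<delta> + 2 * \<eta>" using s'(3) t'(3) commute[of t t'] by (simp add: \<delta>_def)
      have I: "minorizing_integral T d m \<phi> y (d s' t') \<le> ennreal b'"
        if x: "x \<in> {s, t}" and y: "y \<in> T" "\<tau> y x < ennreal \<eta>" for x y
      proof -
        have xT: "x \<in> T" using x s t by auto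
        have "minorizing_integral T d m \<phi> y (d s' t') \<le> minorizing_integral T d m \<phi> y (\<delta> + 2 * \<eta>)"
          by (intro minorizing_integral_mono[OF young] d')
        also have "\<dots> \<le> minorizing_integral T d m \<phi> y (d x y) + minorizing_integral T d m \<phi> x (\<delta> + 2 * \<eta>)"
          using xT y \<delta> \<eta> by (intro minorizing_integral_shift[OF young]) auto
        also have "\<dots> \<le> ennreal \<eta> + (ennreal b + ennreal c * ennreal (2 * \<eta>))"
        proof (intro add_mono)
          show "minorizing_integral T d m \<phi> y (d x y) \<le> ennreal \<eta>"
            using y(2) unfolding minorizing_metric_def commute[of x y] by auto
          have "minorizing_integral T d m \<phi> x (\<delta> + 2 * \<eta>) \<le> minorizing_integral T d m \<phi> x \<delta>
              + young_inv \<phi> (1 / emeasure m (mcball x \<delta>)) * ennreal (2 * \<eta>)"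
            using xT \<delta> \<eta> by (intro minorizing_integral_extend[OF young]) auto
          also have "\<dots> \<le> ennreal b + ennreal c * ennreal (2 * \<eta>)"
            using x le_b c by (intro add_mono mult_right_mono) auto
          finally show "minorizing_integral T d m \<phi> x (\<delta> + 2 * \<eta>) \<le> ennreal b + ennreal c * ennreal (2 * \<eta>)" .
        qed
        also have "\<dots> = ennreal b'"
          using b c \<eta> by (simp add: b'_def algebra_simps flip: ennreal_mult ennreal_plus)
        finally show ?thesis .
      qed
      have "\<tau> s' t' \<le> ennreal b'"
        using I[of s s'] I[of t t'] s' t' by (simp add: minorizing_metric_def)
      then obtain b2 where b2: "\<tau> s' t' = ennreal b2" "0 \<le> b2" "b2 \<le> b'"
      proof (cases "\<tau> s' t'")
        case (real b2)
        moreover have "0 \<le> b'" using b c \<eta> by (simp add: b'_def)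
        ultimately show ?thesis using that \<open>\<tau> s' t' \<le> ennreal b'\<close> by simp
      next
        case top
        then show ?thesis using \<open>\<tau> s' t' \<le> ennreal b'\<close> by (simp add: top_unique)
      qed
      have "\<bar>f s' - f t'\<bar> \<le> chain_const * \<Lambda> * b2"
        using chained[OF s'(1) t'(1)] b2 \<Lambda> unfolding chained_def by blast
      also have "\<dots> \<le> chain_const * \<Lambda> * b'" using b2 chain_const_pos \<open>0 \<le> \<Lambda>\<close> by (intro mult_left_mono) auto
      finally have "\<bar>f s - f t\<bar> \<le> chain_const * \<Lambda> * b' + 2 * \<eta>" using s'(5) t'(5) by linarith
      then show ?thesis by (simp add: b'_def algebra_simps)
    qed
    show ?thesis
    proof (rule field_le_epsilon)
      fix e :: real assume e: "0 < e"
      define C where "C = 2 + chain_const * \<Lambda> * (1 + 2 * c)"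
      have C: "0 < C" using chain_const_pos \<open>0 \<le> \<Lambda>\<close> c by (simp add: C_def add_pos_nonneg)
      show "\<bar>f s - f t\<bar> \<le> chain_const * \<Lambda> * b + e"
        using bound[of "e / C"] e C by (simp flip: C_def)
    qed
  qed
qed

section \<open>Moment bounds and almost sure chaining for a process\<close>

context
  fixes M :: "'b measure" and X :: "'a \<Rightarrow> 'b \<Rightarrow> real"
  assumes M: "prob_space M" and X: "\<And>t. t \<in> T \<Longrightarrow> X t \<in> borel_measurable M"
    and increments: "\<And>s t. s \<in> T \<Longrightarrow> t \<in> T \<Longrightarrow>
      (\<integral>\<^sup>+ \<omega>. ennreal (\<psi> (\<bar>X s \<omega> - X t \<omega>\<bar> / d s t)) \<partial>M) \<le> 1"
begin

lemma quotient_measurable: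
  assumes "p \<in> T \<times> T"
  shows "(\<lambda>\<omega>. \<psi> (diff_quotient d (\<lambda>u. X u \<omega>) p)) \<in> borel_measurable M"
proof (rule young_measurable[OF psi(1)])
  obtain u v where p: "p = (u, v)" by (cases p)
  then have [measurable]: "X u \<in> borel_measurable M" "X v \<in> borel_measurable M"
    using assms X by auto
  show "(\<lambda>\<omega>. diff_quotient d (\<lambda>u. X u \<omega>) p) \<in> borel_measurable M"
    unfolding p diff_quotient_def by simp
qed (auto simp: diff_quotient_def split: prod.split)

lemma energy_summand_measurable:
  assumes "p \<in> links k"
  shows "(\<lambda>\<omega>. ennreal (weight k * plus_part \<psi> (diff_quotient d (\<lambda>u. X u \<omega>) p))) \<in> borel_measurable M"
proof -
  have [measurable]: "(\<lambda>\<omega>. \<psi> (diff_quotient d (\<lambda>u. X u \<omega>) p)) \<in> borel_measurable M"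
    using assms links_subset by (intro quotient_measurable) blast
  show ?thesis unfolding plus_part_def by measurable
qed

lemma energy_measurable [measurable]: "(\<lambda>\<omega>. energy (\<lambda>u. X u \<omega>)) \<in> borel_measurable M"
  unfolding energy_def by (intro borel_measurable_suminf_order borel_measurable_sum energy_summand_measurable)

text \<open>On each link \<open>plus_part \<psi> \<le> \<psi>\<close>, and \<psi> of the quotient
  has mean at most one; the weights sum to at most one.\<close>

lemma energy_expectation: "(\<integral>\<^sup>+ \<omega>. energy (\<lambda>u. X u \<omega>) \<partial>M) \<le> 1"
proof -
  have meas: "(\<lambda>\<omega>. \<psi> (diff_quotient d (\<lambda>u. X u \<omega>) p)) \<in> borel_measurable M"
    if "p \<in> links k" for p k using that links_subset by (intro quotient_measurable) blast
  have "(\<integral>\<^sup>+ \<omega>. energy (\<lambda>u. X u \<omega>) \<partial>M)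
      = (\<Sum>k. \<integral>\<^sup>+ \<omega>. (\<Sum>p\<in>links k. ennreal (weight k * plus_part \<psi> (diff_quotient d (\<lambda>u. X u \<omega>) p))) \<partial>M)"
    unfolding energy_def
    by (intro nn_integral_suminf borel_measurable_sum energy_summand_measurable)
  also have "\<dots>
      = (\<Sum>k. \<Sum>p\<in>links k. \<integral>\<^sup>+ \<omega>. ennreal (weight k * plus_part \<psi> (diff_quotient d (\<lambda>u. X u \<omega>) p)) \<partial>M)"
    by (rule suminf_cong, rule nn_integral_sum, rule energy_summand_measurable)
  also have "\<dots> \<le> (\<Sum>k. \<Sum>p\<in>links k. ennreal (weight k))"
  proof (intro suminf_le sum_mono)
    fix k p assume p: "p \<in> links k"
    obtain u v where uv: "p = (u, v)" "u \<in> T" "v \<in> T" using p links_subset by blast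
    have "(\<integral>\<^sup>+ \<omega>. ennreal (weight k * plus_part \<psi> (diff_quotient d (\<lambda>u. X u \<omega>) p)) \<partial>M)
        \<le> (\<integral>\<^sup>+ \<omega>. ennreal (weight k) * ennreal (\<psi> (diff_quotient d (\<lambda>u. X u \<omega>) p)) \<partial>M)"
    proof (intro nn_integral_mono)
      fix \<omega>
      have "0 \<le> \<psi> (diff_quotient d (\<lambda>u. X u \<omega>) p)"
        by (rule young_nonneg[OF psi(1)]) (simp add: diff_quotient_def uv)
      then show "ennreal (weight k * plus_part \<psi> (diff_quotient d (\<lambda>u. X u \<omega>) p))
          \<le> ennreal (weight k) * ennreal (\<psi> (diff_quotient d (\<lambda>u. X u \<omega>) p))"
        using weight_pos[of k]
        by (subst ennreal_mult[symmetric]) (auto simp: plus_part_def intro!: ennreal_leI divide_right_mono)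
    qed
    also have "\<dots> = ennreal (weight k) * (\<integral>\<^sup>+ \<omega>. ennreal (\<psi> (diff_quotient d (\<lambda>u. X u \<omega>) p)) \<partial>M)"
      using meas[OF p] by (intro nn_integral_cmult) simp
    also have "\<dots> \<le> ennreal (weight k) * 1"
      using increments[OF uv(2,3)] by (intro mult_left_mono) (simp_all add: uv diff_quotient_def)
    finally show "(\<integral>\<^sup>+ \<omega>. ennreal (weight k * plus_part \<psi> (diff_quotient d (\<lambda>u. X u \<omega>) p)) \<partial>M)
        \<le> ennreal (weight k)" by simp
  qed auto
  also have "\<dots> \<le> 1" by (rule weight_total)
  finally show ?thesis .
qed

lemma half_energy_expectation: "(\<integral>\<^sup>+ \<omega>. (1 + energy (\<lambda>u. X u \<omega>)) / 2 \<partial>M) \<le> 1"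
proof -
  interpret M: prob_space M by (rule M)
  have "(\<integral>\<^sup>+ \<omega>. (1 + energy (\<lambda>u. X u \<omega>)) / 2 \<partial>M) = (1 + (\<integral>\<^sup>+ \<omega>. energy (\<lambda>u. X u \<omega>) \<partial>M)) / 2"
    by (simp add: nn_integral_divide nn_integral_add M.emeasure_space_1)
  also have "\<dots> \<le> (1 + 1) / 2"
    using energy_expectation by (intro divide_right_mono_ennreal add_left_mono)
  also have "\<dots> = 1" by (simp add: ennreal_divide_self)
  finally show ?thesis .
qed

text \<open>The quotient \<open>q\<close> satisfies \<open>q \<le> 1 + \<psi> q\<close>, since
  \<psi> dominates the identity from 1 on.\<close>

lemma increment_expectation:
  assumes s: "s \<in> T" and t: "t \<in> T"
  shows "(\<integral>\<^sup>+ \<omega>. ennreal \<bar>X s \<omega> - X t \<omega>\<bar> \<partial>M) \<le> ennreal (2 * d s t)"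
proof (cases "s = t")
  case False
  interpret M: prob_space M by (rule M)
  define q where "q \<omega> = diff_quotient d (\<lambda>u. X u \<omega>) (s, t)" for \<omega>
  have dpos: "0 < d s t" using False s t mdist_pos_less by blast
  have meas: "(\<lambda>\<omega>. \<psi> (q \<omega>)) \<in> borel_measurable M"
    unfolding q_def using s t by (intro quotient_measurable) auto
  have q0: "0 \<le> q \<omega>" for \<omega> by (simp add: q_def diff_quotient_def)
  have "(\<integral>\<^sup>+ \<omega>. ennreal \<bar>X s \<omega> - X t \<omega>\<bar> \<partial>M) \<le> (\<integral>\<^sup>+ \<omega>. ennreal (d s t) * (1 + ennreal (\<psi> (q \<omega>))) \<partial>M)"
  proof (intro nn_integral_mono)
    fix \<omega>
    have "q \<omega> \<le> 1 + \<psi> (q \<omega>)"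
      using young_ge_self[OF psi, of "q \<omega>"] young_nonneg[OF psi(1) q0[of \<omega>]] by linarith
    then have "d s t * q \<omega> \<le> d s t * (1 + \<psi> (q \<omega>))" using dpos by (intro mult_left_mono) auto
    then have "ennreal \<bar>X s \<omega> - X t \<omega>\<bar> \<le> ennreal (d s t * (1 + \<psi> (q \<omega>)))"
      using dpos by (intro ennreal_leI) (simp add: q_def diff_quotient_def)
    then show "ennreal \<bar>X s \<omega> - X t \<omega>\<bar> \<le> ennreal (d s t) * (1 + ennreal (\<psi> (q \<omega>)))"
      using dpos young_nonneg[OF psi(1) q0[of \<omega>]] by (simp add: ennreal_mult)
  qed
  also have "\<dots> = ennreal (d s t) * (1 + (\<integral>\<^sup>+ \<omega>. ennreal (\<psi> (q \<omega>)) \<partial>M))"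
    using meas by (simp add: nn_integral_cmult nn_integral_add M.emeasure_space_1)
  also have "\<dots> \<le> ennreal (d s t) * (1 + 1)"
    using increments[OF s t] by (intro mult_left_mono add_left_mono) (simp_all add: q_def diff_quotient_def)
  also have "\<dots> = ennreal (2 * d s t)" using dpos by (simp add: ennreal_mult mult.commute)
  finally show ?thesis .
qed simp

text \<open>The mean distances to the projections are at most \<open>6 * radius n x\<close>, hence
  summable, so almost surely the distances themselves are summable.\<close>

lemma proj_converges_AE:
  assumes x: "x \<in> T" and fin: "minorizing_integral T d m \<phi> x \<delta> < \<infinity>" "0 < \<delta>"
  shows "AE \<omega> in M. (\<lambda>n. X (proj n x) \<omega>) \<longlonglongrightarrow> X x \<omega>"
proof -
  have [measurable]: "X x \<in> borel_measurable M" "X (proj n x) \<in> borel_measurable M" for n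
    using X x by auto
  have "(\<integral>\<^sup>+ \<omega>. (\<Sum>n. ennreal \<bar>X x \<omega> - X (proj n x) \<omega>\<bar>) \<partial>M)
      = (\<Sum>n. \<integral>\<^sup>+ \<omega>. ennreal \<bar>X x \<omega> - X (proj n x) \<omega>\<bar> \<partial>M)"
    by (intro nn_integral_suminf) measurable
  also have "\<dots> \<le> (\<Sum>n. ennreal (6 * radius n x))"
  proof (intro suminf_le)
    fix n
    have "(\<integral>\<^sup>+ \<omega>. ennreal \<bar>X x \<omega> - X (proj n x) \<omega>\<bar> \<partial>M) \<le> ennreal (2 * d x (proj n x))"
      using x by (intro increment_expectation) auto
    also have "\<dots> \<le> ennreal (6 * radius n x)" using proj(2)[OF x, of n] by (intro ennreal_leI) simp
    finally show "(\<integral>\<^sup>+ \<omega>. ennreal \<bar>X x \<omega> - X (proj n x) \<omega>\<bar> \<partial>M) \<le> ennreal (6 * radius n x)" .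
  qed auto
  also have "\<dots> = ennreal (\<Sum>n. 6 * radius n x)"
    using radius_nonneg[OF x] summable_radius[OF x fin] by (intro suminf_ennreal2) (auto intro: summable_mult)
  finally have "(\<integral>\<^sup>+ \<omega>. (\<Sum>n. ennreal \<bar>X x \<omega> - X (proj n x) \<omega>\<bar>) \<partial>M) \<noteq> \<infinity>" by (auto simp: top_unique)
  then have "AE \<omega> in M. (\<Sum>n. ennreal \<bar>X x \<omega> - X (proj n x) \<omega>\<bar>) \<noteq> \<infinity>"
    by (intro nn_integral_PInf_AE) auto
  then show ?thesis
  proof eventually_elim
    case (elim \<omega>)
    then have "summable (\<lambda>n. \<bar>X x \<omega> - X (proj n x) \<omega>\<bar>)"
      by (intro summable_suminf_not_top) auto
    then have "(\<lambda>n. \<bar>X x \<omega> - X (proj n x) \<omega>\<bar>) \<longlonglongrightarrow> 0" by (rule summable_LIMSEQ_zero)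
    then have "(\<lambda>n. X x \<omega> - X (proj n x) \<omega>) \<longlonglongrightarrow> 0" by (simp add: tendsto_rabs_zero_iff)
    then have "(\<lambda>n. X x \<omega> - (X x \<omega> - X (proj n x) \<omega>)) \<longlonglongrightarrow> X x \<omega> - 0"
      by (intro tendsto_diff tendsto_const)
    then show ?case by simp
  qed
qed

lemma chained_AE_countable:
  assumes S: "countable S" "S \<subseteq> T"
  shows "AE \<omega> in M. \<forall>s\<in>S. \<forall>t\<in>S. chained (\<lambda>u. X u \<omega>) s t"
proof -
  have "AE \<omega> in M. chained (\<lambda>u. X u \<omega>) s t" if "s \<in> S" "t \<in> S" for s t
  proof (cases "s \<noteq> t \<and> \<tau> s t < \<infinity>")
    case True
    have st: "s \<in> T" "t \<in> T" using that S by auto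
    then have "0 < d s t" using True mdist_pos_less by blast
    then have "AE \<omega> in M. (\<lambda>n. X (proj n s) \<omega>) \<longlonglongrightarrow> X s \<omega>" "AE \<omega> in M. (\<lambda>n. X (proj n t) \<omega>) \<longlonglongrightarrow> X t \<omega>"
      using proj_converges_AE minorizing_metric_finite[of s t] True st by blast+
    then show ?thesis
      by eventually_elim (use st in \<open>auto intro!: chained_if_convergent\<close>)
  next
    case False
    have "s \<in> T" "t \<in> T" using that S by auto
    then have "chained (\<lambda>u. X u \<omega>) s t" for \<omega> using False by (intro chained_if_convergent) auto
    then show ?thesis by simp
  qed
  then show ?thesis by (simp add: AE_ball_countable S)
qed

text \<open>Neighbourhoods in the refined topology can be taken small in both \<open>d\<close> and
  \<tau>, so the separating set approximates points as \<open>chained_approx\<close> demands. Off a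
  null set the inequality thus spreads from a countable set to all of \<open>T\<close>.\<close>

lemma chained_AE_separable:
  assumes "doob_separable M (minorizing_topology T d m \<phi>) X"
  shows "AE \<omega> in M. \<forall>s\<in>T. \<forall>t\<in>T. chained (\<lambda>u. X u \<omega>) s t"
proof -
  define A where "A = minorizing_topology T d m \<phi>"
  have open_metric: "openin A U" if "openin mtopology U" for U
    unfolding A_def minorizing_topology_def using that by (intro topology_generated_by_Basis) auto
  have open_tau: "openin A {s\<in>T. \<tau> s t < ennreal e}"
    if "t \<in> T" "0 < e" "minorizing_integral T d m \<phi> t 1 < \<infinity>" for t e
    unfolding A_def minorizing_topology_def using that by (intro topology_generated_by_Basis) auto
  have topA: "topspace A = T"
  proof (rule equalityI)
    show "topspace A \<subseteq> T"
      unfolding A_def minorizing_topology_def topology_generated_by_topspace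
      using openin_subset[of mtopology] by auto
    show "T \<subseteq> topspace A"
      using openin_subset[OF open_metric[OF openin_topspace]] by simp
  qed
  obtain S N0 where S: "countable S" "S \<subseteq> T" and N0: "N0 \<in> null_sets M"
    and sep: "\<And>G F. openin A G \<Longrightarrow> closed F \<Longrightarrow>
        {\<omega> \<in> space M. \<forall>t\<in>G \<inter> S. X t \<omega> \<in> F} - {\<omega> \<in> space M. \<forall>t\<in>G. X t \<omega> \<in> F} \<subseteq> N0"
    using assms topA unfolding doob_separable_def A_def by auto
  show ?thesis
    using chained_AE_countable[OF S] AE_not_in[OF N0] AE_space
  proof eventually_elim
    case (elim \<omega>)
    have "chained (\<lambda>u. X u \<omega>) s t" if st: "s \<in> T" "t \<in> T" for s t
    proof (rule chained_approx[OF st, where S = S])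
      fix x \<eta> assume x: "x \<in> {s, t}" and \<eta>: "0 < (\<eta> :: real)"
        and fin: "minorizing_integral T d m \<phi> x 1 < \<infinity>"
      have xT: "x \<in> T" using x st by auto
      define G where "G = mball x \<eta> \<inter> {y\<in>T. \<tau> y x < ennreal \<eta>}"
      have G: "openin A G"
        unfolding G_def using xT \<eta> fin by (intro openin_Int open_metric open_tau) auto
      have xG: "x \<in> G" using xT \<eta> minorizing_metric_refl[OF young xT] by (simp add: G_def)
      \<comment> \<open>If all values on \<open>G \<inter> S\<close> lay in \<open>F\<close>,
        separability would put the value at \<open>x\<close> itself into \<open>F\<close>.\<close>
      define F where "F = {z. \<eta> \<le> \<bar>z - X x \<omega>\<bar>}"
      have "closed F" unfolding F_def by (intro closed_Collect_le continuous_intros)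
      have "\<not> (\<forall>y\<in>G \<inter> S. X y \<omega> \<in> F)"
      proof
        assume "\<forall>y\<in>G \<inter> S. X y \<omega> \<in> F"
        then have "\<forall>y\<in>G. X y \<omega> \<in> F" using sep[OF G \<open>closed F\<close>] elim(2,3) by blast
        then have "X x \<omega> \<in> F" using xG by blast
        then show False using \<eta> by (simp add: F_def)
      qed
      then obtain y where "y \<in> G" "y \<in> S" "\<bar>X y \<omega> - X x \<omega>\<bar> < \<eta>" by (auto simp: F_def not_le)
      then show "\<exists>y\<in>S. y \<in> T \<and> d y x < \<eta> \<and> \<tau> y x < ennreal \<eta> \<and> \<bar>X y \<omega> - X x \<omega>\<bar> < \<eta>"
        using commute[of x y] by (auto simp: G_def)
    qed (use elim in blast)
    then show ?case by blast
  qed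
qed

text \<open>The supremum over \<open>T\<close> may fail to be measurable; it is dominated almost
  everywhere by \<open>(1 + energy) / 2\<close>, a measurable function of mean at most one.\<close>

lemma expectation_sup_le:
  assumes "\<And>S f. (\<And>s t. s \<in> S \<Longrightarrow> t \<in> S \<Longrightarrow> chained f s t) \<Longrightarrow>
      (SUP s\<in>S. SUP t\<in>S. F f s t) \<le> (1 + energy f) / 2"
  shows "expectation_sup M T X F \<le> 1"
    and "doob_separable M (minorizing_topology T d m \<phi>) X \<Longrightarrow> expectation_pointwise_sup M T X F \<le> 1"
proof -
  have *: "(\<integral>\<^sup>+ \<omega>. (SUP s\<in>S. SUP t\<in>S. F (\<lambda>u. X u \<omega>) s t) \<partial>M) \<le> 1"
    if "AE \<omega> in M. \<forall>s\<in>S. \<forall>t\<in>S. chained (\<lambda>u. X u \<omega>) s t" for S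
  proof -
    have "AE \<omega> in M. (SUP s\<in>S. SUP t\<in>S. F (\<lambda>u. X u \<omega>) s t) \<le> (1 + energy (\<lambda>u. X u \<omega>)) / 2"
      using that by eventually_elim (intro assms, blast)
    then have "(\<integral>\<^sup>+ \<omega>. (SUP s\<in>S. SUP t\<in>S. F (\<lambda>u. X u \<omega>) s t) \<partial>M)
        \<le> (\<integral>\<^sup>+ \<omega>. (1 + energy (\<lambda>u. X u \<omega>)) / 2 \<partial>M)"
      by (rule nn_integral_mono_AE)
    then show ?thesis using half_energy_expectation by (rule order.trans)
  qed
  show "expectation_sup M T X F \<le> 1"
    unfolding expectation_sup_def by (intro SUP_least *) (auto intro: chained_AE_countable)
  show "doob_separable M (minorizing_topology T d m \<phi>) X \<Longrightarrow> expectation_pointwise_sup M T X F \<le> 1"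
    unfolding expectation_pointwise_sup_def by (intro * chained_AE_separable)
qed

end

end

section \<open>The two assertions of the theorem for a fixed space\<close>

context weighted_chaining
begin

lemma minorizing_measure_exists:
  assumes K: "2 * chain_const \<le> K"
  shows "\<exists>\<nu>. borel_probability (prod_topology mtopology mtopology) \<nu> \<and>
    (\<forall>f. continuous_map mtopology euclideanreal f \<longrightarrow>
      (\<forall>s\<in>T. \<forall>t\<in>T. \<tau> s t \<noteq> \<infinity> \<longrightarrow>
         ennreal \<bar>f s - f t\<bar> \<le> ennreal K * luxemburg (plus_part \<psi>) \<nu> (diff_quotient d f) * \<tau> s t) \<and>
      (\<psi> \<in> nabla_prime \<longrightarrow>
        (\<forall>r>1. (\<forall>x\<ge>1. \<forall>y\<ge>1. \<psi> x * \<psi> y \<le> \<psi> (r * x * y)) \<longrightarrow>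
          (SUP s\<in>T. SUP t\<in>T. ext_top (plus_part \<psi>) (scaled_increment (K * r) \<tau> f s t))
            \<le> (\<integral>\<^sup>+ p. ennreal (plus_part \<psi> (diff_quotient d f p)) \<partial>\<nu>))))"
proof -
  obtain \<nu> where \<nu>: "borel_probability (prod_topology mtopology mtopology) \<nu>"
    "\<And>k p g. p \<in> links k \<Longrightarrow> ennreal (weight k) * g p \<le> (\<integral>\<^sup>+ q. g q \<partial>\<nu>)"
    using chaining_measure_exists by blast
  have "chain_const \<le> K" using K chain_const_pos by linarith
  then show ?thesis
    using \<nu>(1) luxemburg_inequality[OF \<nu>(2) _ K] nabla_inequality[OF \<nu>(2)]
    by (intro exI[of _ \<nu>] conjI allI impI ballI) auto
qed

lemma increments_expectation_sup_le:
  fixes M :: "'b measure"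
  assumes K: "chain_const \<le> K" "chain_const * r \<le> K"
    and r: "1 < r" "\<And>x y. \<psi> \<in> nabla_prime \<Longrightarrow> 1 \<le> x \<Longrightarrow> 1 \<le> y \<Longrightarrow> \<psi> x * \<psi> y \<le> \<psi> (r * x * y)"
    and M: "prob_space M" "\<forall>t\<in>T. X t \<in> borel_measurable M"
    and sup: "(SUP s\<in>T. SUP t\<in>T. \<integral>\<^sup>+ \<omega>. ennreal (\<psi> (\<bar>X s \<omega> - X t \<omega>\<bar> / d s t)) \<partial>M) \<le> 1"
  shows "expectation_sup M T X (scaled_increment (2 * K) \<tau>) \<le> 1 \<and>
    (\<psi> \<in> nabla_prime \<longrightarrow>
       expectation_sup M T X (\<lambda>x s t. ext_top \<psi> (scaled_increment (2 * K) \<tau> x s t)) \<le> 1) \<and>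
    (doob_separable M (minorizing_topology T d m \<phi>) X \<longrightarrow>
       expectation_pointwise_sup M T X (scaled_increment (2 * K) \<tau>) \<le> 1 \<and>
       (\<psi> \<in> nabla_prime \<longrightarrow>
          expectation_pointwise_sup M T X
            (\<lambda>x s t. ext_top \<psi> (scaled_increment (2 * K) \<tau> x s t)) \<le> 1))"
proof -
  have X: "X t \<in> borel_measurable M" if "t \<in> T" for t using M(2) that by blast
  have inc: "(\<integral>\<^sup>+ \<omega>. ennreal (\<psi> (\<bar>X s \<omega> - X t \<omega>\<bar> / d s t)) \<partial>M) \<le> 1"
    if "s \<in> T" "t \<in> T" for s t
    using sup that by (simp add: SUP_le_iff)
  have nabla: "(SUP s\<in>S. SUP t\<in>S. ext_top \<psi> (scaled_increment (2 * K) \<tau> f s t)) \<le> (1 + energy f) / 2"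
    if "\<psi> \<in> nabla_prime" "\<And>s t. s \<in> S \<Longrightarrow> t \<in> S \<Longrightarrow> chained f s t" for S f
    using that r(2) by (intro sup_young_increment_le[OF _ K(2) r(1)]) auto
  show ?thesis
    using expectation_sup_le[OF M(1) X inc, of "scaled_increment (2 * K) \<tau>"]
      expectation_sup_le[OF M(1) X inc, of "\<lambda>x s t. ext_top \<psi> (scaled_increment (2 * K) \<tau> x s t)"]
      sup_increment_le[OF _ K(1)] nabla by simp
qed

end

theorem corollary1:
  fixes \<phi> \<psi> :: "real \<Rightarrow> real"
  assumes "young_function \<phi>" and "young_function \<psi>" and "\<phi> 1 = 1" and "\<psi> 1 = 1"
    and "\<exists>R::real. \<exists>n0::nat. R > 1 \<and> n0 \<ge> 1 \<and>
           (\<forall>k::nat. k \<ge> 1 \<longrightarrow> \<phi> (R ^ k) / \<phi> (R ^ (k + 1)) \<le> \<phi> (R ^ (k - 1)) / \<phi> (R ^ k)) \<and>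
           summable (\<lambda>k::nat. \<phi> (R ^ k) / \<psi> (R ^ (k + n0)))"
  shows "\<exists>K::real. K > 0 \<and>
    (\<forall>(T :: 'a set) d m.
      Metric_space T d \<longrightarrow> compact_space (Metric_space.mtopology T d) \<longrightarrow>
      borel_probability (Metric_space.mtopology T d) m \<longrightarrow>
      (let \<T> = Metric_space.mtopology T d; \<tau> = minorizing_metric T d m \<phi> in
        (\<exists>\<nu>. borel_probability (prod_topology \<T> \<T>) \<nu> \<and>
          (\<forall>f. continuous_map \<T> euclideanreal f \<longrightarrow>
            (\<forall>s\<in>T. \<forall>t\<in>T. \<tau> s t \<noteq> \<infinity> \<longrightarrow>
               ennreal \<bar>f s - f t\<bar> \<le> ennreal K * luxemburg (plus_part \<psi>) \<nu> (diff_quotient d f) * \<tau> s t) \<and>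
            (\<psi> \<in> nabla_prime \<longrightarrow>
              (\<forall>r>1. (\<forall>x\<ge>1. \<forall>y\<ge>1. \<psi> x * \<psi> y \<le> \<psi> (r * x * y)) \<longrightarrow>
                (SUP s\<in>T. SUP t\<in>T. ext_top (plus_part \<psi>) (scaled_increment (K * r) \<tau> f s t))
                  \<le> (\<integral>\<^sup>+ p. ennreal (plus_part \<psi> (diff_quotient d f p)) \<partial>\<nu>))))) \<and>
        (\<forall>(M :: 'b measure) X.
          prob_space M \<longrightarrow> (\<forall>t\<in>T. X t \<in> borel_measurable M) \<longrightarrow> doob_separable M \<T> X \<longrightarrow>
          (SUP s\<in>T. SUP t\<in>T. \<integral>\<^sup>+ \<omega>. ennreal (\<psi> (\<bar>X s \<omega> - X t \<omega>\<bar> / d s t)) \<partial>M) \<le> 1 \<longrightarrow>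
          expectation_sup M T X (scaled_increment (2 * K) \<tau>) \<le> 1 \<and>
          (\<psi> \<in> nabla_prime \<longrightarrow>
             expectation_sup M T X (\<lambda>x s t. ext_top \<psi> (scaled_increment (2 * K) \<tau> x s t)) \<le> 1) \<and>
          (doob_separable M (minorizing_topology T d m \<phi>) X \<longrightarrow>
             expectation_pointwise_sup M T X (scaled_increment (2 * K) \<tau>) \<le> 1 \<and>
             (\<psi> \<in> nabla_prime \<longrightarrow>
                expectation_pointwise_sup M T X
                  (\<lambda>x s t. ext_top \<psi> (scaled_increment (2 * K) \<tau> x s t)) \<le> 1)))))"
proof -
  obtain R :: real and N :: nat where R: "R \<ge> 44" "R > 1"
    and lc: "\<And>k. (\<phi> (R ^ Suc k))\<^sup>2 \<le> \<phi> (R ^ k) * \<phi> (R ^ Suc (Suc k))"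
    and sm: "summable (\<lambda>k. 2 * \<phi> (R ^ Suc (Suc k)) / \<psi> (R ^ (k + N)))"
    and le1: "(\<Sum>k. 2 * \<phi> (R ^ Suc (Suc k)) / \<psi> (R ^ (k + N))) \<le> 1"
    using chaining_parameters[OF assms(1,3,2,4,5), of 44] by auto
  \<comment> \<open>Outside \<open>nabla_prime\<close> the value 2 is a mere default.\<close>
  obtain r where r: "1 < r"
    "\<psi> \<in> nabla_prime \<Longrightarrow> 1 \<le> x \<Longrightarrow> 1 \<le> y \<Longrightarrow> \<psi> x * \<psi> y \<le> \<psi> (r * x * y)" for x y
  proof (cases "\<psi> \<in> nabla_prime")
    case True
    then show ?thesis using nabla_prime_one that by metis
  next
    case False
    then show ?thesis using that[of 2] by simp
  qed
  have one_le: "1 \<le> \<phi> (R ^ k)" for k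
    using young_ge_self[OF assms(1,3), of "R ^ k"] one_le_power[of R k] R by linarith
  have mono: "\<phi> (R ^ k) \<le> \<phi> (R ^ Suc k)" for k
    using R by (intro young_mono[OF assms(1)] power_increasing) auto
  have W: "weighted_chaining T d m \<phi> R \<psi> N"
    if "Metric_space T d" "compact_space (Metric_space.mtopology T d)"
      "borel_probability (Metric_space.mtopology T d) m" for T :: "'a set" and d m
    using that assms R lc sm le1 one_le mono
    by (intro weighted_chaining.intro young_chaining.intro metric_chaining.intro
      compact_metric_measure.intro compact_metric_measure_axioms.intro metric_chaining_axioms.intro
      young_chaining_axioms.intro weighted_chaining_axioms.intro) auto
  define C where "C = 2 * R * R ^ N"
  \<comment> \<open>The factor 2 serves the Luxemburg inequality, the factor \<open>r\<close> the
    \<psi>-moments of processes.\<close>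
  define K where "K = 2 * r * C"
  have "0 < C" using R by (simp add: C_def)
  then have K: "0 < K" "2 * C \<le> K" "C \<le> K" "C * r \<le> K"
    using r(1) mult_right_mono[of 1 r C] by (auto simp: K_def)
  \<comment> \<open>The constant of the locale depends on \<open>R\<close> and \<open>N\<close>
    only, so one \<open>K\<close> serves all spaces and measures.\<close>
  have C: "weighted_chaining.chain_const R N = C"
    if "weighted_chaining T d m \<phi> R \<psi> N" for T :: "'a set" and d m
    using weighted_chaining.chain_const_def[OF that] by (simp add: C_def)
  note part_i = weighted_chaining.minorizing_measure_exists[OF W, where K = K]
  note part_ii = weighted_chaining.increments_expectation_sup_le[OF W, where K = K and r = r]
  show ?thesis
    unfolding Let_def
    apply (intro exI[of _ K] conjI[OF K(1)] allI impI, rule conjI)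
    subgoal premises prems for T d m
      using part_i[OF prems] C[OF W[OF prems]] K by simp
    subgoal premises prems for T d m
      using C[OF W[OF prems]] K r by (intro allI impI, intro part_ii[OF prems]) auto
    done
qed

end
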